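(* Let $0<q,q'<1$. For each $n>0$ let $\pi_n,\tau_n$ be independent random permutations in $S_n$ with $\pi_n\sim\mu_{n,q}$ and $\tau_n\sim\mu_{n,q'}$. There exist constants $\sigma=\sigma(q,q')>0$ and $a=a(q,q')>0$ such that \[ \frac{\mathrm{LCS}(\pi_n,\tau_n)-an}{\sigma\sqrt n}\overset{d}{\longrightarrow}\mathcal N(0,1)\qquad\text{as } n\to\infty, \] where $\overset{d}{\longrightarrow}$ denotes convergence in distribution and $\mathcal N(0,1)$ is the standard Normal distribution.
   Context: $S_n$ is the set of permutations of $[n]=\{1,\dots,n\}$. For $\pi\in S_n$, the inversion number $l(\pi)$ is the number of pairs $(i,j)$ with $1\le i<j\le n$ and $\pi(i)>\pi(j)$. For $q>0$, the $(n,q)$-Mallows measure on $S_n$ is $\mu_{n,q}(\pi)=q^{l(\pi)}/Z_{n,q}$, where $Z_{n,q}$ is the normalizing constant. For $\pi,\tau\in S_n$, the length of the longest common subsequence $\mathrm{LCS}(\pi,\tau)$ is the maximal $m$ for which there exist $i_1<\cdots<i_m$ and $j_1<\cdots<j_m$ in $[n]$ with $\pi(i_k)=\tau(j_k)$ for all $k\in[m]$. *)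

theory Defs
  imports "HOL-Probability.Probability" "HOL-Combinatorics.Permutations"
begin

definition perms :: "nat \<Rightarrow> (nat \<Rightarrow> nat) set" where
  "perms n = {p. p permutes {1..n}}"

definition inversion_number :: "nat \<Rightarrow> (nat \<Rightarrow> nat) \<Rightarrow> nat" where
  "inversion_number n p = card {(i, j). 1 \<le> i \<and> i < j \<and> j \<le> n \<and> p i > p j}"

definition mallows_Z :: "nat \<Rightarrow> real \<Rightarrow> real" where
  "mallows_Z n q = (\<Sum>p\<in>perms n. q ^ inversion_number n p)"

definition mallows_measure :: "nat \<Rightarrow> real \<Rightarrow> (nat \<Rightarrow> nat) measure" where
  "mallows_measure n q =
     point_measure (perms n) (\<lambda>p. ennreal (q ^ inversion_number n p / mallows_Z n q))"

definition is_common_subsequence_length ::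
    "nat \<Rightarrow> (nat \<Rightarrow> nat) \<Rightarrow> (nat \<Rightarrow> nat) \<Rightarrow> nat \<Rightarrow> bool" where
  "is_common_subsequence_length n p t m \<longleftrightarrow>
     (\<exists>i j. strict_mono_on {1..m} i \<and> strict_mono_on {1..m} j \<and>
            i ` {1..m} \<subseteq> {1..n} \<and> j ` {1..m} \<subseteq> {1..n} \<and>
            (\<forall>k\<in>{1..m}. p (i k) = t (j k)))"

definition LCS :: "nat \<Rightarrow> (nat \<Rightarrow> nat) \<Rightarrow> (nat \<Rightarrow> nat) \<Rightarrow> nat" where
  "LCS n p t = Max {m. is_common_subsequence_length n p t m}"

text \<open>The maximum is taken over a finite nonempty set, and the Mallows measure is
  a probability measure.\<close>

lemma is_common_subsequence_length_0: "is_common_subsequence_length n p t 0"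
  by (simp add: is_common_subsequence_length_def)

lemma is_common_subsequence_length_le:
  assumes "is_common_subsequence_length n p t m"
  shows "m \<le> n"
proof -
  from assms obtain i where i: "strict_mono_on {1..m} i" "i ` {1..m} \<subseteq> {1..n}"
    by (auto simp: is_common_subsequence_length_def)
  have "inj_on i {1..m}"
    using i(1) by (rule strict_mono_on_imp_inj_on)
  from card_inj_on_le[OF this i(2)] show ?thesis by simp
qed

lemma finite_common_subsequence_lengths: "finite {m. is_common_subsequence_length n p t m}"
  by (rule finite_subset[of _ "{..n}"]) (auto dest: is_common_subsequence_length_le)

lemma finite_perms: "finite (perms n)"
  by (simp add: perms_def finite_permutations)

lemma mallows_Z_pos:
  assumes "q > 0"
  shows "mallows_Z n q > 0"
proof -
  have "id \<in> perms n" by (simp add: perms_def permutes_id)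
  then show ?thesis
    unfolding mallows_Z_def using assms by (intro sum_pos finite_perms) auto
qed

lemma prob_space_mallows_measure:
  assumes "q > 0"
  shows "prob_space (mallows_measure n q)"
  unfolding mallows_measure_def
proof (rule prob_spaceI)
  let ?f = "\<lambda>p. q ^ inversion_number n p / mallows_Z n q"
  have nonneg: "?f p \<ge> 0" for p
    using assms mallows_Z_pos[OF assms, of n] by simp
  have "(\<Sum>p\<in>perms n. ?f p) = mallows_Z n q / mallows_Z n q"
    by (simp only: mallows_Z_def sum_divide_distrib)
  also have "\<dots> = 1"
    using mallows_Z_pos[OF assms, of n] by simp
  finally have "(\<Sum>p\<in>perms n. ennreal (?f p)) = 1"
    using nonneg by (simp add: sum_ennreal)
  then show "emeasure (point_measure (perms n) (\<lambda>p. ennreal (?f p)))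
      (space (point_measure (perms n) (\<lambda>p. ennreal (?f p)))) = 1"
    by (simp add: space_point_measure emeasure_point_measure_finite finite_perms)
qed

end

theory Submission
  imports Defs
begin

text \<open>
  If both permutations map \<open>{1..k}\<close> onto itself, the pair splits into two pairs of sizes \<open>k\<close> and
  \<open>n - k\<close>, and inversion numbers and LCS are additive over the split. Hence the characteristic function
  \<open>r\<^sub>n(t)\<close> of \<open>LCS - a n\<close>, multiplied by \<open>u\<^sub>n = (1 - q)\<^sup>n (1 - q')\<^sup>n Z\<^sub>n\<^sub>,\<^sub>q Z\<^sub>n\<^sub>,\<^sub>q\<^sub>'\<close>, satisfies a renewal
  equation \<open>r(t) = 1 + F(t) * r(t)\<close>, where \<open>F\<^sub>k(t)\<close> sums over the indecomposable pairs of size \<open>k\<close>, and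
  \<open>u = r(0)\<close>. The product formula for \<open>Z\<close> makes \<open>u\<close> decrease exponentially fast to a limit \<open>c > 0\<close>, which
  forces the block sizes to have mass \<open>1\<close>, mean \<open>1 / c\<close> and finite second moment.
  Choosing \<open>a\<close> so that the block rewards \<open>LCS - a k\<close> have mean \<open>0\<close>, and writing \<open>V\<close> for their second
  moment, a perturbation argument for the renewal equation yields
  \<open>r\<^sub>n(\<theta> / sqrt n) \<longlonglongrightarrow> c exp (- V c \<theta>\<^sup>2 / 2)\<close>. The CLT with \<open>\<sigma>\<^sup>2 = V c\<close> follows by Levy's continuity
  theorem; \<open>V > 0\<close> because blocks of sizes 1 and 2 with LCS equal to 1 both occur.
\<close>

section \<open>Direct sums of permutations\<close>

lemma perms_I:
  assumes "\<And>i. i \<in> {1..n} \<Longrightarrow> p i \<in> {1..n}" "inj_on p {1..n}" "\<And>i. i \<notin> {1..n} \<Longrightarrow> p i = i"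
  shows "p \<in> perms n"
proof -
  have "p ` {1..n} \<subseteq> {1..n}" using assms(1) by blast
  then have "p ` {1..n} = {1..n}"
    by (rule endo_inj_surj[OF finite_atLeastAtMost _ assms(2)])
  then have "bij_betw p {1..n} {1..n}" using assms(2) by (rule bij_betw_imageI[rotated])
  then show ?thesis
    unfolding perms_def mem_Collect_eq using assms(3) by (rule bij_imp_permutes)
qed

lemma perms_eq_iff: "p \<in> perms n \<Longrightarrow> p i = p j \<longleftrightarrow> i = j"
  unfolding perms_def mem_Collect_eq by (rule inj_eq[OF permutes_inj])

lemma perms_in_iff: "p \<in> perms n \<Longrightarrow> p i \<in> {1..n} \<longleftrightarrow> i \<in> {1..n}"
  unfolding perms_def mem_Collect_eq by (rule permutes_in_image)

lemma perms_outside: "p \<in> perms n \<Longrightarrow> i \<notin> {1..n} \<Longrightarrow> p i = i"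
  unfolding perms_def mem_Collect_eq by (rule permutes_not_in)

lemma perms_0: "p \<in> perms n \<Longrightarrow> p 0 = 0"
  by (rule perms_outside) auto

lemma perms_le_iff:
  assumes "p \<in> perms n"
  shows "p i \<le> n \<longleftrightarrow> i \<le> n"
proof (cases "i \<in> {1..n}")
  case True
  with perms_in_iff[OF assms, of i] show ?thesis by simp
next
  case False
  with perms_outside[OF assms, of i] show ?thesis by simp
qed

lemma perms_pos_iff:
  assumes "p \<in> perms n"
  shows "p i = 0 \<longleftrightarrow> i = 0"
  using perms_eq_iff[OF assms, of i 0] perms_0[OF assms] by simp

lemma perms_zero: "perms 0 = {id}"
  by (simp add: perms_def)

text \<open>Quantifying over all naturals is harmless because members of \<open>perms n\<close> fix
  \<open>0\<close> and everything beyond \<open>n\<close>: for such \<open>p\<close> and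
  \<open>k \<le> n\<close> the condition says that \<open>{1..k}\<close> is mapped onto itself, and
  it holds at \<open>k = n\<close>.\<close>

definition splits :: "(nat \<Rightarrow> nat) \<Rightarrow> nat \<Rightarrow> bool" where
  "splits p k \<longleftrightarrow> (\<forall>i. p i \<le> k \<longleftrightarrow> i \<le> k)"

text \<open>The direct sum of permutations, extended to all naturals so that the size of the second
  summand need not be recorded.\<close>

definition psum :: "nat \<Rightarrow> (nat \<Rightarrow> nat) \<Rightarrow> (nat \<Rightarrow> nat) \<Rightarrow> nat \<Rightarrow> nat" where
  "psum k p r i = (if i \<le> k then p i else k + r (i - k))"

lemma splits_psum:
  assumes "p \<in> perms k" "r \<in> perms m"
  shows "splits (psum k p r) k"
  unfolding splits_def
proof
  fix i show "psum k p r i \<le> k \<longleftrightarrow> i \<le> k"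
    using perms_le_iff[OF assms(1), of i] perms_pos_iff[OF assms(2), of "i - k"]
    by (auto simp: psum_def)
qed

text \<open>Cuts up to \<open>k\<close> see only the first summand. This is what identifies the
  first block of a sum through its least common cut.\<close>

lemma splits_psum_iff:
  assumes "p \<in> perms k" "r \<in> perms m" "j \<le> k"
  shows "splits (psum k p r) j \<longleftrightarrow> splits p j"
proof -
  have "psum k p r i \<le> j \<longleftrightarrow> p i \<le> j" for i
    using perms_le_iff[OF assms(1), of i] perms_pos_iff[OF assms(2), of "i - k"] assms(3) by (auto simp: psum_def)
  then show ?thesis by (simp add: splits_def)
qed

lemma psum_perms:
  assumes p: "p \<in> perms k" and r: "r \<in> perms m"
  shows "psum k p r \<in> perms (k + m)"
proof (rule perms_I)
  fix i assume i: "i \<in> {1..k + m}"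
  show "psum k p r i \<in> {1..k + m}"
  proof (cases "i \<le> k")
    case True
    then show ?thesis using i perms_in_iff[OF p, of i] by (auto simp: psum_def)
  next
    case False
    then show ?thesis using i perms_in_iff[OF r, of "i - k"] by (auto simp: psum_def)
  qed
next
  show "inj_on (psum k p r) {1..k + m}"
  proof (rule inj_onI)
    fix i j assume eq: "psum k p r i = psum k p r j"
    then have "i \<le> k \<longleftrightarrow> j \<le> k"
      using splits_psum[OF p r] unfolding splits_def by metis
    then show "i = j"
      using eq perms_eq_iff[OF p, of i j] perms_eq_iff[OF r, of "i - k" "j - k"]
      by (auto simp: psum_def split: if_splits)
  qed
next
  fix i assume "i \<notin> {1..k + m}"
  then show "psum k p r i = i"
    using perms_0[OF p] perms_outside[OF r, of "i - k"] by (auto simp: psum_def not_le)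
qed

lemma psum_inject:
  assumes "p \<in> perms k" "p' \<in> perms k" "r \<in> perms m" "r' \<in> perms m"
  shows "psum k p r = psum k p' r' \<longleftrightarrow> p = p' \<and> r = r'"
proof
  assume eq: "psum k p r = psum k p' r'"
  have "p i = p' i" for i
    using fun_cong[OF eq, of i] perms_outside[OF assms(1), of i] perms_outside[OF assms(2), of i]
    by (cases "i \<le> k") (auto simp: psum_def)
  moreover have "r i = r' i" for i
    using fun_cong[OF eq, of "i + k"] perms_0[OF assms(3)] perms_0[OF assms(4)] by (cases "i = 0") (auto simp: psum_def)
  ultimately show "p = p' \<and> r = r'" by auto
qed simp

lemma splits_imp_psum:
  assumes p: "p \<in> perms n" and k: "k \<le> n" and sp: "splits p k"
  shows "\<exists>p1\<in>perms k. \<exists>r\<in>perms (n - k). p = psum k p1 r"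
proof (intro bexI)
  define p1 where "p1 i = (if i \<le> k then p i else i)" for i
  \<comment> \<open>Truncated subtraction supplies \<open>r 0 = 0\<close>, since
    \<open>p k \<le> k\<close>.\<close>
  define r where "r i = p (i + k) - k" for i
  have sp': "p i \<le> k \<longleftrightarrow> i \<le> k" for i using sp by (simp add: splits_def)
  show "p = psum k p1 r"
  proof
    fix i show "p i = psum k p1 r i"
      using sp'[of i] by (auto simp: psum_def p1_def r_def)
  qed
  show "p1 \<in> perms k"
  proof (rule perms_I)
    fix i assume "i \<in> {1..k}"
    then show "p1 i \<in> {1..k}"
      using sp'[of i] perms_pos_iff[OF p, of i] by (auto simp: p1_def Suc_le_eq)
  next
    show "inj_on p1 {1..k}"
      using perms_eq_iff[OF p] by (intro inj_onI) (simp add: p1_def)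
  next
    fix i assume "i \<notin> {1..k}"
    then show "p1 i = i" using perms_0[OF p] by (auto simp: p1_def not_le)
  qed
  show "r \<in> perms (n - k)"
  proof (rule perms_I)
    fix i assume "i \<in> {1..n - k}"
    then show "r i \<in> {1..n - k}"
      using sp'[of "i + k"] perms_le_iff[OF p, of "i + k"] by (auto simp: r_def)
  next
    show "inj_on r {1..n - k}"
    proof (rule inj_onI)
      fix i j assume ij: "i \<in> {1..n - k}" "j \<in> {1..n - k}" "r i = r j"
      then have "p (i + k) = p (j + k)"
        using sp'[of "i + k"] sp'[of "j + k"] by (auto simp: r_def)
      then show "i = j" using perms_eq_iff[OF p, of "i + k" "j + k"] by simp
    qed
  next
    fix i assume "i \<notin> {1..n - k}"
    then have "i = 0 \<or> i > n - k" by auto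
    then show "r i = i"
    proof
      assume "i = 0"
      then show ?thesis using sp'[of k] by (simp add: r_def)
    next
      assume "i > n - k"
      then show ?thesis using perms_outside[OF p, of "i + k"] k by (auto simp: r_def)
    qed
  qed
qed

text \<open>No inversion straddles the cut, because every value of the first block is smaller than
  every value of the second.\<close>

lemma inversion_number_psum:
  assumes p: "p \<in> perms k" and r: "r \<in> perms m"
  shows "inversion_number (k + m) (psum k p r) = inversion_number k p + inversion_number m r"
proof -
  define S where "S n p = {(i, j). 1 \<le> i \<and> i < j \<and> j \<le> n \<and> (p i :: nat) > p j}" for n :: nat and p :: "nat \<Rightarrow> nat"
  let ?sh = "\<lambda>(i, j). (i + k, j + k)"
  have fin: "finite (S n p)" for n p
    by (rule finite_subset[of _ "{..n} \<times> {..n}"]) (auto simp: S_def)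
  have lt: "psum k p r i \<le> k \<longleftrightarrow> i \<le> k" for i
    using splits_psum[OF p r] by (simp add: splits_def)
  have "S (k + m) (psum k p r) = S k p \<union> ?sh ` S m r"
  proof (intro equalityI subsetI)
    fix x assume x: "x \<in> S (k + m) (psum k p r)"
    obtain i j where ij: "x = (i, j)" by force
    from x ij have h: "1 \<le> i" "i < j" "j \<le> k + m" "psum k p r i > psum k p r j"
      by (auto simp: S_def)
    show "x \<in> S k p \<union> ?sh ` S m r"
    proof (cases "i \<le> k")
      case True
      with lt[of i] lt[of j] h have "j \<le> k" by linarith
      then show ?thesis using True h ij by (auto simp: S_def psum_def)
    next
      case False
      then have "(i - k, j - k) \<in> S m r" "x = ?sh (i - k, j - k)"
        using h ij by (auto simp: S_def psum_def)
      then show ?thesis by blast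
    qed
  qed (auto simp: S_def psum_def)
  moreover have "S k p \<inter> ?sh ` S m r = {}" by (auto simp: S_def)
  moreover have "inj_on ?sh (S m r)" by (auto intro!: inj_onI)
  ultimately have "card (S (k + m) (psum k p r)) = card (S k p) + card (S m r)"
    using fin by (simp add: card_Un_disjoint card_image)
  then show ?thesis by (simp add: inversion_number_def S_def)
qed

section \<open>Common subsequences as chains of matched positions\<close>

text \<open>Sets of matched position pairs can be restricted, shifted and united without reindexing.
  The equivalence, applied in both orders, also forces distinct pairs to differ in both
  coordinates.\<close>

definition common_chain :: "nat \<Rightarrow> (nat \<Rightarrow> nat) \<Rightarrow> (nat \<Rightarrow> nat) \<Rightarrow> (nat \<times> nat) set \<Rightarrow> bool" where
  "common_chain n p t S \<longleftrightarrow> S \<subseteq> {1..n} \<times> {1..n} \<and> (\<forall>(i, j)\<in>S. p i = t j) \<and>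
     (\<forall>(i, j)\<in>S. \<forall>(i', j')\<in>S. i < i' \<longleftrightarrow> j < j')"

lemma common_chainI:
  assumes "\<And>i j. (i, j) \<in> S \<Longrightarrow> i \<in> {1..n} \<and> j \<in> {1..n} \<and> p i = t j"
    and "\<And>i j i' j'. (i, j) \<in> S \<Longrightarrow> (i', j') \<in> S \<Longrightarrow> i < i' \<longleftrightarrow> j < j'"
  shows "common_chain n p t S"
  unfolding common_chain_def
proof (intro conjI)
  show "S \<subseteq> {1..n} \<times> {1..n}" using assms(1) by auto
  show "\<forall>(i, j)\<in>S. p i = t j" using assms(1) by auto
  show "\<forall>(i, j)\<in>S. \<forall>(i', j')\<in>S. i < i' \<longleftrightarrow> j < j'" using assms(2) by (intro ballI; clarify)
qed

lemma common_chainD: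
  assumes "common_chain n p t S" "(i, j) \<in> S"
  shows "i \<in> {1..n}" "j \<in> {1..n}" "p i = t j"
  using assms by (auto simp: common_chain_def)

lemma common_chain_less:
  assumes "common_chain n p t S" "(i, j) \<in> S" "(i', j') \<in> S"
  shows "i < i' \<longleftrightarrow> j < j'"
proof -
  have "\<forall>x\<in>S. \<forall>y\<in>S. fst x < fst y \<longleftrightarrow> snd x < snd y"
    using assms(1) by (simp add: common_chain_def split_beta)
  from bspec[OF bspec[OF this assms(2)] assms(3)] show ?thesis by simp
qed

lemma common_chain_finite: "common_chain n p t S \<Longrightarrow> finite S"
  by (rule finite_subset[of _ "{1..n} \<times> {1..n}"]) (simp_all add: common_chain_def)

lemma is_common_subsequence_length_iff:
  "is_common_subsequence_length n p t m \<longleftrightarrow> (\<exists>S. common_chain n p t S \<and> card S = m)"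
proof
  assume "is_common_subsequence_length n p t m"
  then obtain i j where ij: "strict_mono_on {1..m} i" "strict_mono_on {1..m} j"
      "i ` {1..m} \<subseteq> {1..n}" "j ` {1..m} \<subseteq> {1..n}" "\<And>k. k \<in> {1..m} \<Longrightarrow> p (i k) = t (j k)"
    by (auto simp: is_common_subsequence_length_def)
  let ?S = "(\<lambda>k. (i k, j k)) ` {1..m}"
  have "common_chain n p t ?S"
  proof (rule common_chainI)
    fix a b assume "(a, b) \<in> ?S"
    then obtain k where k: "k \<in> {1..m}" "a = i k" "b = j k" by auto
    have "i k \<in> {1..n}" "j k \<in> {1..n}" using ij(3,4) k(1) by blast+
    then show "a \<in> {1..n} \<and> b \<in> {1..n} \<and> p a = t b" using ij(5)[OF k(1)] k by simp
  next
    fix a b a' b' assume "(a, b) \<in> ?S" "(a', b') \<in> ?S"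
    then obtain k k' where k: "k \<in> {1..m}" "a = i k" "b = j k" "k' \<in> {1..m}" "a' = i k'" "b' = j k'"
      by auto
    show "a < a' \<longleftrightarrow> b < b'"
      using k strict_mono_on_less[OF ij(1) k(1,4)] strict_mono_on_less[OF ij(2) k(1,4)] by simp
  qed
  moreover have "card ?S = m"
  proof -
    have "inj_on (\<lambda>k. (i k, j k)) {1..m}"
      by (rule inj_onI) (use inj_onD[OF strict_mono_on_imp_inj_on[OF ij(1)]] in blast)
    then show ?thesis by (simp add: card_image)
  qed
  ultimately show "\<exists>S. common_chain n p t S \<and> card S = m" by blast
next
  assume "\<exists>S. common_chain n p t S \<and> card S = m"
  then obtain S where S: "common_chain n p t S" "card S = m" by blast
  note ord = common_chain_less[OF S(1)]
  have inj: "inj_on fst S"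
  proof (rule inj_onI)
    fix x y assume xy: "x \<in> S" "y \<in> S" "fst x = fst y"
    obtain a b b' where eq: "x = (a, b)" "y = (a, b')" using xy(3) by (metis prod.collapse)
    then show "x = y" using ord[of a b a b'] ord[of a b' a b] xy(1,2) by auto
  qed
  have "finite (fst ` S)" using common_chain_finite[OF S(1)] by simp
  then obtain h where h: "bij_betw h {..<card (fst ` S)} (fst ` S)" "strict_mono_on {..<card (fst ` S)} h"
    by (rule ex_bij_betw_strict_mono_card)
  have card: "card (fst ` S) = m" using inj S(2) by (simp add: card_image)
  \<comment> \<open>\<open>h\<close> enumerates the first coordinates increasingly from index
    \<open>0\<close>, while subsequences are indexed from \<open>1\<close>; \<open>j\<close> then
    picks the partner of \<open>i k\<close> in \<open>S\<close>.\<close>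
  define i where "i k = h (k - 1)" for k
  define j where "j k = snd (inv_into S fst (i k))" for k
  have mem: "(i k, j k) \<in> S" if "k \<in> {1..m}" for k
  proof -
    have "k - 1 \<in> {..<m}" using that by auto
    then have *: "i k \<in> fst ` S"
      unfolding i_def using h(1) bij_betwE card by blast
    have "(i k, j k) = inv_into S fst (i k)"
      using f_inv_into_f[OF *] by (simp add: j_def prod_eq_iff)
    then show ?thesis using inv_into_into[OF *] by simp
  qed
  have i: "strict_mono_on {1..m} i"
  proof (rule strict_mono_onI)
    fix r s assume "r \<in> {1..m}" "s \<in> {1..m}" "r < s"
    then show "i r < i s"
      unfolding i_def by (intro strict_mono_onD[OF h(2)[unfolded card]]) auto
  qed
  have j: "strict_mono_on {1..m} j"
  proof (rule strict_mono_onI)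
    fix r s assume rs: "r \<in> {1..m}" "s \<in> {1..m}" "r < s"
    then show "j r < j s"
      using ord[OF mem[OF rs(1)] mem[OF rs(2)]] strict_mono_onD[OF i rs] by simp
  qed
  note D = common_chainD[OF S(1) mem]
  have "i ` {1..m} \<subseteq> {1..n}" "j ` {1..m} \<subseteq> {1..n}"
    by (intro image_subsetI D(1); assumption) (intro image_subsetI D(2); assumption)
  moreover have "\<forall>k\<in>{1..m}. p (i k) = t (j k)" using D(3) by (rule ballI)
  ultimately show "is_common_subsequence_length n p t m"
    unfolding is_common_subsequence_length_def
    by (intro exI[of _ i] exI[of _ j] conjI i j)
qed

lemma card_le_LCS:
  assumes "common_chain n p t S"
  shows "card S \<le> LCS n p t"
  unfolding LCS_def using assms
  by (intro Max_ge finite_common_subsequence_lengths) (auto simp: is_common_subsequence_length_iff)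

lemma LCS_attained: "\<exists>S. common_chain n p t S \<and> card S = LCS n p t"
proof -
  have "LCS n p t \<in> {m. is_common_subsequence_length n p t m}"
    unfolding LCS_def using is_common_subsequence_length_0
    by (intro Max_in finite_common_subsequence_lengths) blast
  then show ?thesis by (simp add: is_common_subsequence_length_iff)
qed

lemma LCS_le: "LCS n p t \<le> n"
  using LCS_attained[of n p t] is_common_subsequence_length_le
  unfolding is_common_subsequence_length_iff[symmetric] by blast

text \<open>Matched positions carry a common value, and in both sums the values at most
  \<open>k\<close> sit exactly at the positions at most \<open>k\<close>. So an optimal chain cuts
  into one chain per block, and conversely chains of the two blocks can be stacked.\<close>

lemma LCS_psum:
  assumes p: "p \<in> perms k" and r: "r \<in> perms m" and t: "t \<in> perms k" and s: "s \<in> perms m"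
  shows "LCS (k + m) (psum k p r) (psum k t s) = LCS k p t + LCS m r s"
proof (rule antisym)
  have le: "psum k p r i \<le> k \<longleftrightarrow> i \<le> k" "psum k t s i \<le> k \<longleftrightarrow> i \<le> k" for i
    using splits_psum[OF p r] splits_psum[OF t s] by (simp_all add: splits_def)
  obtain S where S: "common_chain (k + m) (psum k p r) (psum k t s) S"
      "card S = LCS (k + m) (psum k p r) (psum k t s)"
    using LCS_attained by blast
  have iff: "i \<le> k \<longleftrightarrow> j \<le> k" if "(i, j) \<in> S" for i j
  proof -
    have "psum k p r i = psum k t s j" using that S(1) by (auto simp: common_chain_def)
    then show ?thesis using le by metis
  qed
  define S1 where "S1 = {x \<in> S. fst x \<le> k}"
  define S2 where "S2 = {x \<in> S. \<not> fst x \<le> k}"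
  let ?sh = "\<lambda>(i, j). (i - k, j - k)"
  have S1: "(i, j) \<in> S" "i \<le> k" "j \<le> k" if "(i, j) \<in> S1" for i j
    using that iff[of i j] by (auto simp: S1_def)
  have S2: "(i, j) \<in> S" "\<not> i \<le> k" "\<not> j \<le> k" if "(i, j) \<in> S2" for i j
    using that iff[of i j] by (auto simp: S2_def)
  have "common_chain k p t S1"
  proof (rule common_chainI)
    fix i j assume ij: "(i, j) \<in> S1"
    show "i \<in> {1..k} \<and> j \<in> {1..k} \<and> p i = t j"
      using common_chainD[OF S(1) S1(1)[OF ij]] S1[OF ij] by (auto simp: psum_def)
  next
    fix i j i' j' assume "(i, j) \<in> S1" "(i', j') \<in> S1"
    then show "i < i' \<longleftrightarrow> j < j'" using S1(1) common_chain_less[OF S(1)] by blast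
  qed
  moreover have "common_chain m r s (?sh ` S2)"
  proof (rule common_chainI)
    fix i' j' assume "(i', j') \<in> ?sh ` S2"
    then obtain i j where ij: "(i, j) \<in> S2" "i' = i - k" "j' = j - k" by auto
    then show "i' \<in> {1..m} \<and> j' \<in> {1..m} \<and> r i' = s j'"
      using common_chainD[OF S(1) S2(1)[OF ij(1)]] S2[OF ij(1)] by (auto simp: psum_def)
  next
    fix i' j' a' b' assume "(i', j') \<in> ?sh ` S2" "(a', b') \<in> ?sh ` S2"
    then obtain i j a b where ij: "(i, j) \<in> S2" "i' = i - k" "j' = j - k"
      and ab: "(a, b) \<in> S2" "a' = a - k" "b' = b - k" by auto
    have "i < a \<longleftrightarrow> j < b" using S2(1) ij ab common_chain_less[OF S(1)] by blast
    then show "i' < a' \<longleftrightarrow> j' < b'" using S2[OF ij(1)] S2[OF ab(1)] ij ab by auto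
  qed
  moreover have "card S = card S1 + card (?sh ` S2)"
  proof -
    have "inj_on ?sh S2"
      by (rule inj_onI) (use S2 in fastforce)
    moreover have "card S = card S1 + card S2"
      unfolding S1_def S2_def using common_chain_finite[OF S(1)]
      by (subst card_Un_disjoint[symmetric]) (auto intro!: arg_cong[where f = card])
    ultimately show ?thesis by (simp add: card_image)
  qed
  ultimately show "LCS (k + m) (psum k p r) (psum k t s) \<le> LCS k p t + LCS m r s"
    using card_le_LCS S(2) add_mono by metis
next
  obtain S1 S2 where S: "common_chain k p t S1" "card S1 = LCS k p t"
      "common_chain m r s S2" "card S2 = LCS m r s"
    using LCS_attained by metis
  let ?sh = "\<lambda>(i, j). (i + k, j + k)"
  have "common_chain (k + m) (psum k p r) (psum k t s) (S1 \<union> ?sh ` S2)"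
  proof (rule common_chainI)
    fix i j assume "(i, j) \<in> S1 \<union> ?sh ` S2"
    then consider "(i, j) \<in> S1" | a b where "(a, b) \<in> S2" "i = a + k" "j = b + k" by auto
    then show "i \<in> {1..k + m} \<and> j \<in> {1..k + m} \<and> psum k p r i = psum k t s j"
    proof cases
      case 1
      then show ?thesis using common_chainD[OF S(1) 1] by (auto simp: psum_def)
    next
      case 2
      then show ?thesis using common_chainD[OF S(3) 2(1)] by (auto simp: psum_def)
    qed
  next
    fix i j i' j' assume "(i, j) \<in> S1 \<union> ?sh ` S2" "(i', j') \<in> S1 \<union> ?sh ` S2"
    then consider "(i, j) \<in> S1" "(i', j') \<in> S1"
      | a b where "(i, j) \<in> S1" "(a, b) \<in> S2" "i' = a + k" "j' = b + k"
      | a b where "(i', j') \<in> S1" "(a, b) \<in> S2" "i = a + k" "j = b + k"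
      | a b a' b' where "(a, b) \<in> S2" "i = a + k" "j = b + k" "(a', b') \<in> S2" "i' = a' + k" "j' = b' + k"
      by auto
    then show "i < i' \<longleftrightarrow> j < j'"
    proof cases
      case 1
      then show ?thesis by (rule common_chain_less[OF S(1)])
    next
      case 2
      then show ?thesis using common_chainD[OF S(1) 2(1)] common_chainD[OF S(3) 2(2)] by auto
    next
      case 3
      then show ?thesis using common_chainD[OF S(1) 3(1)] common_chainD[OF S(3) 3(2)] by auto
    next
      case 4
      then show ?thesis using common_chain_less[OF S(3) 4(1) 4(4)] by simp
    qed
  qed
  moreover have "card (S1 \<union> ?sh ` S2) = card S1 + card S2"
  proof -
    have "S1 \<inter> ?sh ` S2 = {}"
      using common_chainD(1)[OF S(1)] common_chainD(1)[OF S(3)] by fastforce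
    moreover have "inj_on ?sh S2" by (auto intro!: inj_onI)
    ultimately show ?thesis
      using common_chain_finite[OF S(1)] common_chain_finite[OF S(3)]
      by (simp add: card_Un_disjoint card_image)
  qed
  ultimately show "LCS k p t + LCS m r s \<le> LCS (k + m) (psum k p r) (psum k t s)"
    using card_le_LCS S by metis
qed

section \<open>First common cut and the renewal identity\<close>

definition pairs :: "nat \<Rightarrow> ((nat \<Rightarrow> nat) \<times> (nat \<Rightarrow> nat)) set" where
  "pairs n = perms n \<times> perms n"

text \<open>Indecomposability belongs to the pair: each component may split on its own, only common
  cuts are forbidden. Size \<open>0\<close> is excluded so that every block has positive
  length.\<close>

definition indec :: "nat \<Rightarrow> ((nat \<Rightarrow> nat) \<times> (nat \<Rightarrow> nat)) set" where
  "indec n = {(p, t) \<in> pairs n. n > 0 \<and> (\<forall>k\<in>{1..<n}. \<not> (splits p k \<and> splits t k))}"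

definition psum2 where
  "psum2 k x y = (psum k (fst x) (fst y), psum k (snd x) (snd y))"

lemma finite_pairs: "finite (pairs n)"
  by (simp add: pairs_def finite_perms)

lemma indec_subset: "indec n \<subseteq> pairs n"
  by (auto simp: indec_def)

lemma finite_indec: "finite (indec n)"
  using indec_subset finite_pairs by (rule finite_subset)

lemma indec_0 [simp]: "indec 0 = {}"
  by (simp add: indec_def)

text \<open>Cutting a pair at its least positive common cut leaves an indecomposable first block and
  an arbitrary rest. That least cut can be read off the sum, whence injectivity.\<close>

lemma bij_betw_psum2:
  assumes "n > 0"
  shows "bij_betw (\<lambda>(k, x, y). psum2 k x y) (SIGMA k:{1..n}. indec k \<times> pairs (n - k)) (pairs n)"
  unfolding bij_betw_def
proof (intro conjI equalityI subsetI)
  have least: "k = (LEAST j. j \<ge> 1 \<and> splits (fst z) j \<and> splits (snd z) j)"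
    if "x \<in> indec k" "y \<in> pairs m" "z = psum2 k x y" for k m x y z
  proof (rule Least_equality[symmetric])
    have mem: "fst x \<in> perms k" "snd x \<in> perms k" "fst y \<in> perms m" "snd y \<in> perms m" "k > 0"
      using that by (auto simp: indec_def pairs_def)
    then show "k \<ge> 1 \<and> splits (fst z) k \<and> splits (snd z) k"
      using that by (auto simp: psum2_def intro: splits_psum)
    fix j assume j: "j \<ge> 1 \<and> splits (fst z) j \<and> splits (snd z) j"
    show "k \<le> j"
    proof (rule ccontr)
      assume "\<not> k \<le> j"
      then have "splits (fst x) j" "splits (snd x) j"
        using j that(3) mem by (simp_all add: psum2_def splits_psum_iff)
      then show False using \<open>\<not> k \<le> j\<close> j that(1) by (auto simp: indec_def)
    qed
  qed
  show "inj_on (\<lambda>(k, x, y). psum2 k x y) (SIGMA k:{1..n}. indec k \<times> pairs (n - k))"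
  proof (rule inj_onI)
    fix z z' assume z: "z \<in> (SIGMA k:{1..n}. indec k \<times> pairs (n - k))"
      "z' \<in> (SIGMA k:{1..n}. indec k \<times> pairs (n - k))"
      "(case z of (k, x, y) \<Rightarrow> psum2 k x y) = (case z' of (k, x, y) \<Rightarrow> psum2 k x y)"
    obtain k p t q s where k: "z = (k, (p, t), (q, s))" by (metis surj_pair)
    obtain k' p' t' q' s' where k': "z' = (k', (p', t'), (q', s'))" by (metis surj_pair)
    have *: "(p, t) \<in> indec k" "(q, s) \<in> pairs (n - k)" "(p', t') \<in> indec k'" "(q', s') \<in> pairs (n - k')"
      "psum2 k (p, t) (q, s) = psum2 k' (p', t') (q', s')"
      using z unfolding k k' by auto
    have kk: "k = k'" using least[OF *(1,2) *(5)[symmetric]] least[OF *(3,4) refl] by (rule trans[OF _ sym])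
    have mem: "p \<in> perms k" "t \<in> perms k" "p' \<in> perms k" "t' \<in> perms k"
      "q \<in> perms (n - k)" "s \<in> perms (n - k)" "q' \<in> perms (n - k)" "s' \<in> perms (n - k)"
      using * kk by (auto simp: indec_def pairs_def)
    have "psum k p q = psum k p' q'" "psum k t s = psum k t' s'"
      using *(5) kk by (auto simp: psum2_def)
    then show "z = z'"
      unfolding k k' using kk mem by (simp add: psum_inject)
  qed
next
  fix z assume "z \<in> (\<lambda>(k, x, y). psum2 k x y) ` (SIGMA k:{1..n}. indec k \<times> pairs (n - k))"
  then obtain k x y where k: "k \<le> n" "x \<in> indec k" "y \<in> pairs (n - k)" "z = psum2 k x y" by auto
  then have "psum k (fst x) (fst y) \<in> perms (k + (n - k))" "psum k (snd x) (snd y) \<in> perms (k + (n - k))"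
    by (intro psum_perms; auto simp: indec_def pairs_def)+
  then show "z \<in> pairs n"
    using k by (simp add: psum2_def pairs_def)
next
  fix z assume "z \<in> pairs n"
  then obtain p t where z: "z = (p, t)" "p \<in> perms n" "t \<in> perms n" by (auto simp: pairs_def)
  define P where "P j \<longleftrightarrow> j \<ge> 1 \<and> splits p j \<and> splits t j" for j
  have "P n" using z perms_le_iff assms by (auto simp: P_def splits_def)
  define k where "k = (LEAST j. P j)"
  have k: "P k" "k \<le> n" unfolding k_def using \<open>P n\<close> by (auto intro: LeastI Least_le)
  have min: "\<not> P j" if "j < k" for j using that not_less_Least unfolding k_def by blast
  obtain p1 p2 where p: "p1 \<in> perms k" "p2 \<in> perms (n - k)" "p = psum k p1 p2"
    using splits_imp_psum[OF z(2) k(2)] k(1) P_def by blast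
  obtain t1 t2 where t: "t1 \<in> perms k" "t2 \<in> perms (n - k)" "t = psum k t1 t2"
    using splits_imp_psum[OF z(3) k(2)] k(1) P_def by blast
  have "(p1, t1) \<in> indec k"
    using p t k(1) min by (auto simp: indec_def pairs_def P_def splits_psum_iff)
  moreover have "(p2, t2) \<in> pairs (n - k)" using p t by (simp add: pairs_def)
  moreover have "z = psum2 k (p1, t1) (p2, t2)" using z p t by (simp add: psum2_def)
  moreover have "k \<in> {1..n}" using k by (simp add: P_def)
  ultimately show "z \<in> (\<lambda>(k, x, y). psum2 k x y) ` (SIGMA k:{1..n}. indec k \<times> pairs (n - k))"
    by force
qed

text \<open>Summing over the first-block decomposition factorises every statistic that is
  multiplicative over direct sums. The general semiring serves both the real weights and the complex
  weights with a phase \<open>cis\<close>.\<close>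

lemma sum_pairs_renewal:
  fixes h :: "nat \<Rightarrow> (nat \<Rightarrow> nat) \<times> (nat \<Rightarrow> nat) \<Rightarrow> 'a :: comm_semiring_1"
  assumes h0: "h 0 (id, id) = 1"
    and mult: "\<And>k m x y. x \<in> pairs k \<Longrightarrow> y \<in> pairs m \<Longrightarrow> h (k + m) (psum2 k x y) = h k x * h m y"
  shows "sum (h n) (pairs n) = (if n = 0 then 1 else 0) + (\<Sum>k\<le>n. sum (h k) (indec k) * sum (h (n - k)) (pairs (n - k)))"
proof (cases "n = 0")
  case True
  then show ?thesis by (simp add: pairs_def perms_zero h0)
next
  case False
  have "sum (h n) (pairs n) = (\<Sum>(k, x, y)\<in>(SIGMA k:{1..n}. indec k \<times> pairs (n - k)). h n (psum2 k x y))"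
    using False by (subst sum.reindex_bij_betw[OF bij_betw_psum2, symmetric]) (auto intro!: sum.cong)
  also have "\<dots> = (\<Sum>k\<in>{1..n}. \<Sum>(x, y)\<in>indec k \<times> pairs (n - k). h n (psum2 k x y))"
    by (subst sum.Sigma) (auto simp: finite_indec finite_pairs)
  also have "\<dots> = (\<Sum>k\<in>{1..n}. sum (h k) (indec k) * sum (h (n - k)) (pairs (n - k)))"
  proof (rule sum.cong)
    fix k assume k: "k \<in> {1..n}"
    have "h n (psum2 k x y) = h k x * h (n - k) y" if "x \<in> indec k" "y \<in> pairs (n - k)" for x y
      using mult[of x k y "n - k"] that k indec_subset by auto
    then show "(\<Sum>(x, y)\<in>indec k \<times> pairs (n - k). h n (psum2 k x y))
        = sum (h k) (indec k) * sum (h (n - k)) (pairs (n - k))"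
      by (auto simp: sum_product sum.cartesian_product intro!: sum.cong)
  qed simp
  \<comment> \<open>The added term \<open>k = 0\<close> vanishes because \<open>indec 0\<close> is
    empty.\<close>
  also have "\<dots> = (\<Sum>k\<le>n. sum (h k) (indec k) * sum (h (n - k)) (pairs (n - k)))"
    by (intro sum.mono_neutral_left) (auto simp: not_less_eq_eq)
  finally show ?thesis using False by simp
qed

section \<open>Product formula for the normalizing constant\<close>

text \<open>Raising the values from \<open>v\<close> on frees \<open>v\<close> for the last
  position; the guard \<open>p i \<le> n\<close> keeps the points beyond \<open>Suc n\<close>
  fixed.\<close>

definition insert_last :: "nat \<Rightarrow> nat \<Rightarrow> (nat \<Rightarrow> nat) \<Rightarrow> nat \<Rightarrow> nat" where
  "insert_last n v p i =
     (if i = Suc n then v else if v \<le> p i \<and> p i \<le> n then Suc (p i) else p i)"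

lemma insert_last_perms:
  assumes p: "p \<in> perms n" and v: "v \<in> {1..Suc n}"
  shows "insert_last n v p \<in> perms (Suc n)"
proof (rule perms_I)
  fix i assume "i \<in> {1..Suc n}"
  then show "insert_last n v p i \<in> {1..Suc n}"
    using v perms_in_iff[OF p, of i] by (auto simp: insert_last_def)
next
  show "inj_on (insert_last n v p) {1..Suc n}"
  proof (rule inj_onI)
    fix i j assume ij: "i \<in> {1..Suc n}" "j \<in> {1..Suc n}" "insert_last n v p i = insert_last n v p j"
    then show "i = j"
      using perms_eq_iff[OF p, of i j] perms_in_iff[OF p, of i] perms_in_iff[OF p, of j] v
      by (auto simp: insert_last_def split: if_splits)
  qed
next
  fix i assume "i \<notin> {1..Suc n}"
  then show "insert_last n v p i = i"
    using perms_outside[OF p, of i] v by (auto simp: insert_last_def)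
qed

text \<open>Surjectivity comes from counting: by injectivity the image has
  \<open>Suc n * fact n = fact (Suc n)\<close> elements.\<close>

lemma bij_betw_insert_last:
  "bij_betw (\<lambda>(v, p). insert_last n v p) ({1..Suc n} \<times> perms n) (perms (Suc n))"
  unfolding bij_betw_def
proof (intro conjI)
  show inj: "inj_on (\<lambda>(v, p). insert_last n v p) ({1..Suc n} \<times> perms n)"
  proof (rule inj_onI, clarify)
    fix v p v' p' assume *: "v \<in> {1..Suc n}" "v' \<in> {1..Suc n}" "p \<in> perms n" "p' \<in> perms n"
      "insert_last n v p = insert_last n v' p'"
    have v: "v = v'" using fun_cong[OF *(5), of "Suc n"] by (simp add: insert_last_def)
    have "p i = p' i" for i
      using fun_cong[OF *(5), of i] perms_le_iff[OF *(3), of i] perms_le_iff[OF *(4), of i]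
        perms_outside[OF *(3), of i] perms_outside[OF *(4), of i]
      unfolding v by (cases "i = Suc n") (auto simp: insert_last_def split: if_splits)
    with v show "v = v' \<and> p = p'" by auto
  qed
  have "card (perms n) = fact n" for n
    unfolding perms_def by (rule card_permutations) auto
  then have "card ((\<lambda>(v, p). insert_last n v p) ` ({1..Suc n} \<times> perms n)) = card (perms (Suc n))"
    unfolding card_image[OF inj] card_cartesian_product by simp
  then show "(\<lambda>(v, p). insert_last n v p) ` ({1..Suc n} \<times> perms n) = perms (Suc n)"
    by (intro card_subset_eq finite_perms) (auto intro: insert_last_perms)
qed

text \<open>Raising values preserves the order among the first \<open>n\<close> positions, so the
  new inversions pair the last position with the \<open>Suc n - v\<close> positions whose old value
  is at least \<open>v\<close>.\<close>

lemma inversion_number_insert_last: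
  assumes p: "p \<in> perms n" and v: "v \<in> {1..Suc n}"
  shows "inversion_number (Suc n) (insert_last n v p) = inversion_number n p + (Suc n - v)"
proof -
  let ?g = "insert_last n v p"
  define S where "S n p = {(i, j). 1 \<le> i \<and> i < j \<and> j \<le> n \<and> (p i :: nat) > p j}" for n :: nat and p :: "nat \<Rightarrow> nat"
  define J where "J = {i \<in> {1..n}. v \<le> p i}"
  have fin: "finite (S n p)" for n p
    by (rule finite_subset[of _ "{..n} \<times> {..n}"]) (auto simp: S_def)
  have le: "p i \<le> n" if "i \<le> n" for i using that perms_le_iff[OF p] by simp
  have lt: "?g i > ?g j \<longleftrightarrow> p i > p j" if "i \<le> n" "j \<le> n" for i j
    using that le[of i] le[of j] by (auto simp: insert_last_def)
  have last: "?g i > ?g (Suc n) \<longleftrightarrow> v \<le> p i" if "i \<le> n" for i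
    using that le[of i] by (auto simp: insert_last_def)
  have "S (Suc n) ?g = S n p \<union> (\<lambda>i. (i, Suc n)) ` J"
  proof (intro equalityI subsetI)
    fix x assume x: "x \<in> S (Suc n) ?g"
    obtain i j where ij: "x = (i, j)" by force
    from x ij have h: "1 \<le> i" "i < j" "j \<le> Suc n" "?g i > ?g j" by (auto simp: S_def)
    show "x \<in> S n p \<union> (\<lambda>i. (i, Suc n)) ` J"
    proof (cases "j = Suc n")
      case True
      then show ?thesis using h ij last[of i] by (auto simp: J_def)
    next
      case False
      then show ?thesis using h ij lt[of i j] by (auto simp: S_def)
    qed
  next
    fix x assume "x \<in> S n p \<union> (\<lambda>i. (i, Suc n)) ` J"
    then show "x \<in> S (Suc n) ?g"
      using lt last by (auto simp: S_def J_def)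
  qed
  moreover have "S n p \<inter> (\<lambda>i. (i, Suc n)) ` J = {}" by (auto simp: S_def)
  moreover have "card ((\<lambda>i. (i, Suc n)) ` J) = card J" by (intro card_image inj_onI) auto
  moreover have "finite J" by (simp add: J_def)
  moreover have "card J = Suc n - v"
  proof -
    have "p ` J = {v..n}"
    proof (intro equalityI subsetI)
      fix y assume y: "y \<in> {v..n}"
      have "p ` {1..n} = {1..n}" using p unfolding perms_def by (simp add: permutes_image)
      then obtain i where "i \<in> {1..n}" "y = p i" using y v by (metis atLeastAtMost_iff imageE order_trans)
      then show "y \<in> p ` J" using y by (auto simp: J_def)
    qed (use le in \<open>auto simp: J_def\<close>)
    moreover have "inj_on p J" using perms_eq_iff[OF p] by (auto intro!: inj_onI)
    ultimately show ?thesis using card_image by fastforce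
  qed
  ultimately have "card (S (Suc n) ?g) = card (S n p) + (Suc n - v)"
    using fin by (simp add: card_Un_disjoint)
  then show ?thesis by (simp add: inversion_number_def S_def)
qed

lemma mallows_Z_Suc: "mallows_Z (Suc n) q = (\<Sum>i\<le>n. q ^ i) * mallows_Z n q"
proof -
  have "mallows_Z (Suc n) q = (\<Sum>(v, p)\<in>{1..Suc n} \<times> perms n. q ^ inversion_number (Suc n) (insert_last n v p))"
    unfolding mallows_Z_def
    by (subst sum.reindex_bij_betw[OF bij_betw_insert_last, symmetric]) (auto intro!: sum.cong)
  also have "\<dots> = (\<Sum>(v, p)\<in>{1..Suc n} \<times> perms n. q ^ (Suc n - v) * q ^ inversion_number n p)"
  proof (rule sum.cong; clarify)
    fix v p assume "v \<in> {1..Suc n}" "p \<in> perms n"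
    then show "q ^ inversion_number (Suc n) (insert_last n v p) = q ^ (Suc n - v) * q ^ inversion_number n p"
      by (simp only: inversion_number_insert_last power_add mult.commute)
  qed
  also have "\<dots> = (\<Sum>v\<in>{1..Suc n}. q ^ (Suc n - v)) * mallows_Z n q"
    unfolding mallows_Z_def by (simp only: sum_product sum.cartesian_product)
  also have "(\<Sum>v\<in>{1..Suc n}. q ^ (Suc n - v)) = (\<Sum>i\<le>n. q ^ i)"
    by (rule sum.reindex_bij_witness[of _ "\<lambda>i. Suc n - i" "\<lambda>v. Suc n - v"]) auto
  finally show ?thesis .
qed

text \<open>\<open>mallows_Z n q\<close> is the q-factorial, and \<open>1 - q\<close> turns each of
  its geometric factors into one \<open>1 - q ^ i\<close>. For \<open>0 < q < 1\<close> the
  normalised product converges.\<close>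

lemma mallows_Z_prod: "(1 - q) ^ n * mallows_Z n q = (\<Prod>i=1..n. 1 - q ^ i)"
proof (induction n)
  case 0
  have "inversion_number 0 id = 0" 
    unfolding inversion_number_def by (subst card_eq_0_iff) auto
  then show ?case by (simp add: mallows_Z_def perms_zero)
next
  case (Suc n)
  have "(1 - q) * (\<Sum>i\<le>n. q ^ i) = 1 - q ^ Suc n"
    by (rule sum_gp_basic)
  moreover have "(1 - q) ^ Suc n * mallows_Z (Suc n) q
      = ((1 - q) * (\<Sum>i\<le>n. q ^ i)) * ((1 - q) ^ n * mallows_Z n q)"
    by (simp only: mallows_Z_Suc power_Suc mult_ac)
  ultimately have eq: "(1 - q) ^ Suc n * mallows_Z (Suc n) q = (1 - q ^ Suc n) * ((1 - q) ^ n * mallows_Z n q)"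
    by (simp only:)
  show ?case unfolding eq Suc.IH by (simp add: mult.commute)
qed

section \<open>Renewal sequences\<close>

text \<open>The classical direction is reversed: \<open>u\<close> is the known sequence and
  properties of \<open>f\<close> are to be deduced. Thus \<open>f\<close> is not assumed to have
  mass one; its mass and moments come from the positive limit and the decay of
  \<open>u\<close>.\<close>

locale renewal =
  fixes f u :: "nat \<Rightarrow> real" and c :: real
  assumes f_nonneg: "f k \<ge> 0" and f_0 [simp]: "f 0 = 0"
    and u_rec: "u n = (if n = 0 then 1 else 0) + (\<Sum>k\<le>n. f k * u (n - k))"
    and u_decseq: "decseq u" and u_lim: "u \<longlonglongrightarrow> c" and c_pos: "c > 0"
    and diff_moment: "summable (\<lambda>n. real (Suc n) * (u n - u (Suc n)))"
begin

text \<open>These become the tails of \<open>f\<close> once its mass is known to be one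
  (\<open>sum_H_tail\<close>). The partial-sum form makes them the coefficients of
  \<open>(1 - f) / (1 - X)\<close> beforehand.\<close>

definition H :: "nat \<Rightarrow> real" where "H n = 1 - (\<Sum>k\<le>n. f k)"

text \<open>The coefficients of \<open>(1 - X) U\<close>, that is, increments of \<open>u\<close>
  when \<open>u\<close> is continued by \<open>0\<close> to the left.\<close>

definition du :: "nat \<Rightarrow> real" where "du n = (if n = 0 then 1 else u n - u (n - 1))"

lemma u_0 [simp]: "u 0 = 1"
  using u_rec[of 0] by simp

lemma u_ge: "u n \<ge> c"
  using u_decseq u_lim by (simp add: decseq_ge)

lemma u_le_1: "u n \<le> 1"
  using decseqD[OF u_decseq, of 0 n] by simp

lemma fps_u_mult: "Abs_fps u * (1 - Abs_fps f) = 1"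
proof -
  have "Abs_fps u = 1 + Abs_fps f * Abs_fps u"
  proof (rule fps_ext)
    fix n show "fps_nth (Abs_fps u) n = fps_nth (1 + Abs_fps f * Abs_fps u) n"
      using u_rec[of n] by (simp add: fps_mult_nth atLeast0AtMost)
  qed
  then show ?thesis by (simp add: algebra_simps)
qed

lemma fps_du: "(1 - fps_X) * Abs_fps u = Abs_fps du"
  by (rule fps_ext) (simp add: du_def algebra_simps fps_X_mult_nth)

lemma fps_H: "(1 - fps_X) * Abs_fps H = 1 - Abs_fps f"
proof (rule fps_ext)
  fix n show "fps_nth ((1 - fps_X) * Abs_fps H) n = fps_nth (1 - Abs_fps f) n"
    by (cases n) (simp_all add: H_def algebra_simps fps_X_mult_nth)
qed

text \<open>The factor \<open>1 - X\<close> divided out of \<open>1 - f\<close> to form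
  \<open>H\<close> is the one multiplied into \<open>U\<close>, so the product collapses to the
  renewal equation \<open>U (1 - f) = 1\<close>.\<close>

lemma fps_du_H: "Abs_fps du * Abs_fps H = 1"
proof -
  have "Abs_fps du * Abs_fps H = Abs_fps u * ((1 - fps_X) * Abs_fps H)"
    by (simp add: fps_du[symmetric] mult_ac)
  then show ?thesis by (simp add: fps_H fps_u_mult)
qed

lemma du_nonpos: "n > 0 \<Longrightarrow> du n \<le> 0"
  using decseqD[OF u_decseq, of "n - 1" n] by (simp add: du_def)

lemma H_0 [simp]: "H 0 = 1" by (simp add: H_def)

text \<open>\<open>D\<close> has leading coefficient \<open>1\<close> and no positive later
  coefficient, so \<open>D H = 1\<close> writes each \<open>H n\<close> as a nonnegative combination
  of earlier values.\<close>

lemma H_nonneg: "H n \<ge> 0"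
proof (induction n rule: less_induct)
  case (less n)
  show ?case
  proof (cases "n = 0")
    case False
    have "0 = fps_nth (Abs_fps du * Abs_fps H) n"
      using False by (simp add: fps_du_H)
    also have "\<dots> = (\<Sum>i\<in>{0..n}. du i * H (n - i))"
      by (simp add: fps_mult_nth)
    also have "\<dots> = H n + (\<Sum>i\<in>{1..n}. du i * H (n - i))"
      by (simp add: sum.atLeast_Suc_atMost du_def)
    finally have "H n = (\<Sum>i\<in>{1..n}. (- du i) * H (n - i))"
      by (simp add: sum_negf)
    also have "\<dots> \<ge> 0"
      using less du_nonpos by (intro sum_nonneg mult_nonneg_nonneg) auto
    finally show ?thesis .
  qed simp
qed

text \<open>Coefficient form of \<open>H U = 1 / (1 - X)\<close>. For a probability \<open>f\<close>
  it sorts by the position of the last renewal up to \<open>n\<close>.\<close>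

lemma u_conv_H: "(\<Sum>i\<le>n. H i * u (n - i)) = 1"
proof -
  have "(1 - fps_X) * (Abs_fps H * Abs_fps u) = 1"
    using fps_du_H by (simp add: fps_du[symmetric] mult_ac)
  moreover have "(1 - fps_X) * Abs_fps (\<lambda>_. 1 :: real) = 1"
    by (rule fps_ext) (simp add: algebra_simps fps_X_mult_nth)
  ultimately have "Abs_fps H * Abs_fps u = Abs_fps (\<lambda>_. 1)"
    by (metis mult.left_commute mult.right_neutral)
  from arg_cong[OF this, of "\<lambda>g. fps_nth g n"] show ?thesis
    by (simp add: fps_mult_nth atLeast0AtMost)
qed

text \<open>As \<open>u n \<ge> c\<close>, the identity \<open>u_conv_H\<close> bounds
  \<open>c\<close> times every partial sum by \<open>1\<close>.\<close>

lemma summable_H: "summable H"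
proof (rule summableI_nonneg_bounded[of _ "1 / c"])
  fix n
  have "c * (\<Sum>i<n. H i) \<le> (\<Sum>i\<le>n. H i * c)"
    by (simp add: sum_distrib_left sum_distrib_right mult.commute
        lessThan_Suc_atMost[symmetric] H_nonneg c_pos less_imp_le)
  also have "\<dots> \<le> (\<Sum>i\<le>n. H i * u (n - i))"
    by (intro sum_mono mult_left_mono u_ge H_nonneg)
  finally show "sum H {..<n} \<le> 1 / c"
    using c_pos by (simp add: u_conv_H field_simps)
qed (rule H_nonneg)

lemma du_sums: "du sums c"
proof -
  have "(\<Sum>i<Suc n. du i) = u n" for n
    by (induction n) (auto simp: du_def)
  then show ?thesis
    using u_lim unfolding sums_def by (subst filterlim_sequentially_Suc[symmetric]) simp
qed

lemma summable_norm_du: "summable (\<lambda>n. norm (du n))"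
proof -
  have "summable (\<lambda>n. norm (du (Suc n)))"
    using sums_summable[OF du_sums] du_nonpos
    by (subst (asm) summable_Suc_iff[symmetric]) (simp add: summable_minus_iff)
  then show ?thesis by (simp only: summable_Suc_iff[of "\<lambda>n. norm (du n)"])
qed

text \<open>Evaluation of \<open>D H = 1\<close> at \<open>X = 1\<close> through the Cauchy product,
  where \<open>D\<close> sums to \<open>c\<close>.\<close>

lemma suminf_H: "suminf H = 1 / c"
proof -
  have "(\<lambda>k. \<Sum>i\<le>k. du i * H (k - i)) sums (suminf du * suminf H)"
    using summable_norm_du summable_H H_nonneg by (intro Cauchy_product_sums) auto
  also have "(\<lambda>k. \<Sum>i\<le>k. du i * H (k - i)) = (\<lambda>k. fps_nth (Abs_fps du * Abs_fps H) k)"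
    by (simp add: fps_mult_nth atLeast0AtMost)
  finally have "(\<lambda>k. if k = 0 then 1 else 0) sums (c * suminf H)"
    using du_sums by (simp add: fps_du_H sums_iff)
  moreover have "(\<lambda>k. if k = 0 then 1 else 0 :: real) sums 1"
    using sums_single[of 0 "\<lambda>_. 1::real"] by simp
  ultimately have "c * suminf H = 1" by (simp add: sums_unique2)
  then show ?thesis using c_pos by (simp add: field_simps)
qed

text \<open>Differentiating \<open>D H = 1\<close>, where \<open>D = (1 - X) U\<close> is the generating function of \<open>du\<close>, gives
  \<open>H' = - D' H\<^sup>2\<close>, a product of series with absolutely summable coefficients.\<close>

lemma summable_moment_H: "summable (\<lambda>n. real n * H n)"
proof -
  let ?H = "Abs_fps H" and ?D = "Abs_fps du"
  have "fps_deriv (?D * ?H) = 0" by (simp add: fps_du_H)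
  then have "?D * fps_deriv ?H = - fps_deriv ?D * ?H"
    by (simp add: eq_neg_iff_add_eq_0 mult_ac add.commute)
  then have "?H * (?D * fps_deriv ?H) = - fps_deriv ?D * (?H * ?H)"
    by (simp add: mult_ac)
  then have eq: "fps_deriv ?H = - fps_deriv ?D * (?H * ?H)"
    using fps_du_H by (metis mult.assoc mult.commute mult.left_neutral)
  have HH: "summable (\<lambda>n. \<Sum>i\<le>n. H i * H (n - i))"
    using summable_H H_nonneg by (intro summable_Cauchy_product) auto
  have "summable (\<lambda>n. \<Sum>i\<le>n. - (real (Suc i) * du (Suc i)) * (\<Sum>j\<le>n - i. H j * H (n - i - j)))"
  proof (rule summable_Cauchy_product)
    show "summable (\<lambda>k. norm (- (real (Suc k) * du (Suc k))))"
      using diff_moment by (simp add: du_def abs_mult decseqD[OF u_decseq] abs_of_nonpos)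
    show "summable (\<lambda>k. norm (\<Sum>j\<le>k. H j * H (k - j)))"
      using HH by (simp add: abs_of_nonneg sum_nonneg H_nonneg)
  qed
  also have "(\<lambda>n. \<Sum>i\<le>n. - (real (Suc i) * du (Suc i)) * (\<Sum>j\<le>n - i. H j * H (n - i - j)))
      = (\<lambda>n. fps_nth (fps_deriv ?H) n)"
    by (rule ext, subst eq) (simp add: fps_mult_nth atLeast0AtMost sum_negf)
  finally have "summable (\<lambda>n. real (Suc n) * H (Suc n))" by simp
  then show ?thesis by (simp only: summable_Suc_iff[of "\<lambda>n. real n * H n"])
qed

text \<open>Summability of \<open>H\<close> forces \<open>H n\<close> to \<open>0\<close>, so no
  mass is missing.\<close>

lemma f_sums: "f sums 1"
proof -
  have "(\<lambda>n. 1 - H n) \<longlonglongrightarrow> 1 - 0"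
    by (intro tendsto_intros summable_LIMSEQ_zero summable_H)
  then show ?thesis by (simp add: H_def sums_def_le)
qed

text \<open>Summation by parts with \<open>f (Suc k) = H k - H (Suc k)\<close>; in the next lemma
  the increments \<open>2 * k + 1\<close> of the squares appear.\<close>

lemma sum_moment1: "(\<Sum>k\<le>n. real k * f k) = (\<Sum>k<n. H k) - real n * H n"
  by (induction n) (auto simp: H_def algebra_simps)

lemma sum_moment2: "(\<Sum>k\<le>n. (real k)\<^sup>2 * f k) = (\<Sum>k<n. (2 * real k + 1) * H k) - (real n)\<^sup>2 * H n"
  by (induction n) (auto simp: H_def algebra_simps power2_eq_square)

text \<open>The boundary term \<open>n * H n\<close> vanishes in the limit because \<open>H\<close>
  has a finite first moment.\<close>

lemma f_moment1: "(\<lambda>k. real k * f k) sums (1 / c)"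
proof -
  have "(\<lambda>n. (\<Sum>k<n. H k) - real n * H n) \<longlonglongrightarrow> 1 / c - 0"
    unfolding suminf_H[symmetric]
    by (intro tendsto_intros summable_LIMSEQ_zero summable_LIMSEQ summable_H summable_moment_H)
  then show ?thesis by (simp add: sum_moment1 sums_def_le)
qed

lemma f_moment2: "summable (\<lambda>k. (real k)\<^sup>2 * f k)"
proof (rule summableI_nonneg_bounded)
  have *: "summable (\<lambda>k. (2 * real k + 1) * H k)"
    using summable_add[OF summable_mult[OF summable_moment_H, of 2] summable_H]
    by (simp add: algebra_simps)
  fix n
  have "(\<Sum>k<n. (real k)\<^sup>2 * f k) \<le> (\<Sum>k\<le>n. (real k)\<^sup>2 * f k)"
    by (intro sum_mono2) (auto simp: f_nonneg)
  \<comment> \<open>The boundary term has a favourable sign and is dropped.\<close>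
  also have "\<dots> \<le> (\<Sum>k<n. (2 * real k + 1) * H k)"
    by (simp add: sum_moment2 H_nonneg)
  also have "\<dots> \<le> (\<Sum>k. (2 * real k + 1) * H k)"
    by (intro sum_le_suminf *) (auto simp: H_nonneg)
  finally show "(\<Sum>k<n. (real k)\<^sup>2 * f k) \<le> \<dots>" .
qed (simp add: f_nonneg)

end

section \<open>A central limit theorem for renewal rewards\<close>

text \<open>Dominated convergence for series. The bound is asked only for positive \<open>n\<close>,
  which suits terms normalised by \<open>n\<close>.\<close>

lemma tannery_sequentially:
  fixes a :: "nat \<Rightarrow> nat \<Rightarrow> complex"
  assumes "\<And>k. (\<lambda>n. a k n) \<longlonglongrightarrow> b k" and "\<And>k n. n > 0 \<Longrightarrow> norm (a k n) \<le> M k" and "summable M"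
  shows "(\<lambda>n. \<Sum>k. a k n) \<longlonglongrightarrow> (\<Sum>k. b k)"
proof -
  have "eventually (\<lambda>(k, n). norm (a k n) \<le> M k) (sequentially \<times>\<^sub>F sequentially)"
    using eventually_prodI[OF always_eventually[of "\<lambda>_. True"] eventually_gt_at_top[of "0::nat"], of sequentially]
    by (rule eventually_mono) (auto simp: assms(2))
  from tannerys_theorem[OF assms(1) this assms(3)] show ?thesis by simp
qed

lemma lim_const_over_sqrt: "(\<lambda>n. a / sqrt (real n)) \<longlonglongrightarrow> 0"
  by (rule real_tendsto_divide_at_top[OF tendsto_const])
    (rule filterlim_compose[OF sqrt_at_top filterlim_real_sequentially])

text \<open>The exponent is \<open>h * y\<close> with \<open>h = 1 / sqrt n\<close> and
  \<open>y\<close> tending to \<open>\<i> * \<alpha>\<close>; after scaling by \<open>n\<close> the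
  quadratic term involves \<open>y\<close> alone and the cubic remainder is of order
  \<open>h\<close>. The linear phase, of order \<open>sqrt n\<close> after scaling, is subtracted
  here and cancels later because rewards have mean zero.\<close>

lemma exp_second_order_limit:
  fixes \<alpha> b :: real
  shows "(\<lambda>n. of_nat n * (exp (\<i> * of_real (\<alpha> / sqrt n) + of_real (b / n)) - 1 - \<i> * of_real (\<alpha> / sqrt n)))
    \<longlonglongrightarrow> (of_real (b - \<alpha>\<^sup>2 / 2) :: complex)"
proof -
  define h where "h n = 1 / sqrt (real n)" for n
  define y where "y n = \<i> * of_real \<alpha> + of_real (b * h n)" for n
  define z where "z n = of_real (h n) * y n" for n
  define e where "e n = exp (z n) - (\<Sum>k\<le>2. z n ^ k / fact k)" for n
  have h0: "h \<longlonglongrightarrow> 0" unfolding h_def by (rule lim_const_over_sqrt)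
  have h2: "real n * (h n)\<^sup>2 = 1" if "n > 0" for n
    using that by (simp add: h_def power_divide)
  have h2': "(h n)\<^sup>2 = 1 / n" for n by (simp add: h_def power_divide)
  have z_eq: "z n = \<i> * of_real (\<alpha> / sqrt n) + of_real (b / n)" for n
  proof -
    have "z n = \<i> * of_real (\<alpha> * h n) + of_real (b * (h n)\<^sup>2)"
      by (simp add: z_def y_def algebra_simps power2_eq_square)
    then show ?thesis by (simp only: h2') (simp add: h_def)
  qed
  have y_lim: "y \<longlonglongrightarrow> \<i> * of_real \<alpha>"
  proof -
    have "y \<longlonglongrightarrow> \<i> * of_real \<alpha> + of_real (b * 0)"
      unfolding y_def by (intro tendsto_intros h0)
    then show ?thesis by simp
  qed
  have main: "of_nat n * (exp (z n) - 1 - \<i> * of_real (\<alpha> / sqrt n)) = of_nat n * e n + (of_real b + (y n)\<^sup>2 / 2)"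
    if "n > 0" for n
  proof -
    have "of_nat n * (z n)\<^sup>2 = of_real (real n * (h n)\<^sup>2) * (y n)\<^sup>2"
      by (simp add: z_def power_mult_distrib)
    then have 1: "of_nat n * (z n)\<^sup>2 = (y n)\<^sup>2" using h2[OF that] by simp
    have 2: "of_nat n * (z n - \<i> * of_real (\<alpha> / sqrt n)) = of_real b"
      using that by (simp add: z_eq)
    have "exp (z n) = e n + 1 + z n + (z n)\<^sup>2 / 2"
      by (simp add: e_def numeral_2_eq_2)
    then have "of_nat n * (exp (z n) - 1 - \<i> * of_real (\<alpha> / sqrt n)) =
        of_nat n * e n + (of_nat n * (z n - \<i> * of_real (\<alpha> / sqrt n)) + of_nat n * (z n)\<^sup>2 / 2)"
      by (simp add: algebra_simps)
    then show ?thesis by (simp only: 1 2)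
  qed
  have e0: "(\<lambda>n. of_nat n * e n) \<longlonglongrightarrow> 0"
  proof (rule Lim_null_comparison)
    show "\<forall>\<^sub>F n in sequentially. norm (of_nat n * e n) \<le> exp \<bar>b * (h n)\<^sup>2\<bar> * (norm (y n)) ^ 3 * h n / 2"
      using eventually_gt_at_top[of 0]
    proof eventually_elim
      case (elim n)
      have "Re (z n) = b * (h n)\<^sup>2" by (simp add: z_def y_def power2_eq_square)
      then have "norm (e n) \<le> exp \<bar>b * (h n)\<^sup>2\<bar> * norm (z n) ^ 3 / 2"
        using Taylor_exp[of "z n" 2] by (simp add: e_def numeral_3_eq_3 numeral_2_eq_2)
      then have "real n * norm (e n) \<le> real n * (exp \<bar>b * (h n)\<^sup>2\<bar> * norm (z n) ^ 3 / 2)"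
        by (intro mult_left_mono) auto
      also have "norm (z n) ^ 3 = (h n)\<^sup>2 * (h n * norm (y n) ^ 3)"
      proof -
        have "norm (z n) = h n * norm (y n)" by (simp add: z_def norm_mult norm_divide h_def)
        then show ?thesis by (simp add: power_mult_distrib power3_eq_cube power2_eq_square)
      qed
      also have "real n * (exp \<bar>b * (h n)\<^sup>2\<bar> * ((h n)\<^sup>2 * (h n * norm (y n) ^ 3)) / 2)
          = (real n * (h n)\<^sup>2) * (exp \<bar>b * (h n)\<^sup>2\<bar> * (norm (y n)) ^ 3 * h n / 2)"
        by (simp add: mult_ac)
      finally show ?case using h2[OF elim] by (simp add: norm_mult)
    qed
    have "(\<lambda>n. exp \<bar>b * (h n)\<^sup>2\<bar> * (norm (y n)) ^ 3 * h n / 2)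
        \<longlonglongrightarrow> exp \<bar>b * 0\<^sup>2\<bar> * norm (\<i> * complex_of_real \<alpha>) ^ 3 * 0 / 2"
      by (intro tendsto_intros h0 y_lim) auto
    then show "(\<lambda>n. exp \<bar>b * (h n)\<^sup>2\<bar> * (norm (y n)) ^ 3 * h n / 2) \<longlonglongrightarrow> 0" by simp
  qed
  have "(\<lambda>n. of_nat n * e n + (of_real b + (y n)\<^sup>2 / 2)) \<longlonglongrightarrow> 0 + (of_real b + (\<i> * of_real \<alpha>)\<^sup>2 / 2)"
    by (intro tendsto_intros e0 y_lim) auto
  then have "(\<lambda>n. of_nat n * e n + (of_real b + (y n)\<^sup>2 / 2)) \<longlonglongrightarrow> of_real (b - \<alpha>\<^sup>2 / 2)"
    by (simp add: power_mult_distrib)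
  moreover have "\<forall>\<^sub>F n in sequentially. of_nat n * e n + (of_real b + (y n)\<^sup>2 / 2)
      = of_nat n * (exp (z n) - 1 - \<i> * of_real (\<alpha> / sqrt n))"
    using eventually_gt_at_top[of 0] by eventually_elim (simp only: main)
  ultimately show ?thesis
    unfolding z_eq by (rule Lim_transform_eventually)
qed

text \<open>Supplies the majorant for dominated convergence: quadratic growth in \<open>k\<close> is
  what the second moment of \<open>f\<close> can absorb. The condition \<open>k \<le> n\<close>
  keeps the real part of the exponent at most \<open>b\<close>.\<close>

lemma exp_second_order_bound:
  fixes \<theta> b y :: real
  assumes "b \<ge> 0" "k \<le> n" "n > 0" "\<bar>y\<bar> \<le> real k"
  shows "norm (of_nat n * (exp (\<i> * of_real (\<theta> / sqrt n * y) + of_real (b * k / n)) - 1 - \<i> * of_real (\<theta> / sqrt n * y)))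
    \<le> (exp b * (\<bar>\<theta>\<bar> + b)\<^sup>2 + b) * (real k)\<^sup>2"
proof -
  define z where "z = \<i> * of_real (\<theta> / sqrt n * y) + of_real (b * k / n)"
  have n1: "sqrt (real n) \<ge> 1" "real n > 0" using assms by auto
  have Re: "\<bar>Re z\<bar> \<le> b"
    using assms by (simp add: z_def field_simps mult_left_mono)
  have "norm z \<le> norm (\<i> * complex_of_real (\<theta> / sqrt n * y)) + norm (complex_of_real (b * k / n))"
    unfolding z_def by (rule norm_triangle_ineq)
  also have "\<dots> = \<bar>\<theta>\<bar> * \<bar>y\<bar> / sqrt n + b * k / n"
    using assms by (simp only: norm_mult norm_of_real norm_ii) (simp add: abs_mult)
  also have "\<dots> \<le> \<bar>\<theta>\<bar> * k / sqrt n + b * k / sqrt n"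
  proof (intro add_mono)
    show "\<bar>\<theta>\<bar> * \<bar>y\<bar> / sqrt n \<le> \<bar>\<theta>\<bar> * k / sqrt n"
      using assms by (intro divide_right_mono mult_left_mono) auto
    \<comment> \<open>Weakening \<open>1 / n\<close> to \<open>1 / sqrt n\<close> gives both parts a
      common factor, whose square cancels the \<open>n\<close> in front.\<close>
    have "sqrt (real n) \<le> sqrt (real n) * sqrt (real n)"
      using n1 by (simp only: mult_le_cancel_left1) auto
    then have "sqrt (real n) \<le> real n" by simp
    then show "b * k / n \<le> b * k / sqrt n"
      using n1 assms by (intro divide_left_mono) auto
  qed
  also have "\<dots> = (\<bar>\<theta>\<bar> + b) * k / sqrt n"
    by (simp add: add_divide_distrib algebra_simps)
  finally have nz: "norm z \<le> (\<bar>\<theta>\<bar> + b) * k / sqrt n" .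
  have "norm (exp z - 1 - z) \<le> exp \<bar>Re z\<bar> * (norm z)\<^sup>2"
    using Taylor_exp[of z 1] by (simp add: numeral_2_eq_2 algebra_simps)
  also have "\<dots> \<le> exp b * ((\<bar>\<theta>\<bar> + b) * k / sqrt n)\<^sup>2"
    using Re nz by (intro mult_mono power_mono) auto
  also have "\<dots> = exp b * (\<bar>\<theta>\<bar> + b)\<^sup>2 * (real k)\<^sup>2 / n"
    by (simp add: power_mult_distrib power_divide)
  finally have 1: "real n * norm (exp z - 1 - z) \<le> exp b * (\<bar>\<theta>\<bar> + b)\<^sup>2 * (real k)\<^sup>2"
    using n1 by (simp add: field_simps)
  have "real k \<le> (real k)\<^sup>2" by (cases k) (auto simp: power2_eq_square)
  then have "b * real k \<le> b * (real k)\<^sup>2"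
    using assms by (intro mult_left_mono) auto
  moreover have "of_nat n * (exp z - 1 - \<i> * of_real (\<theta> / sqrt n * y))
      = of_nat n * (exp z - 1 - z) + of_real (b * k)"
    using n1 by (simp add: z_def field_simps)
  moreover have "norm (of_nat n * (exp z - 1 - z) + of_real (b * k)) \<le> real n * norm (exp z - 1 - z) + b * k"
    using assms by (intro order_trans[OF norm_triangle_ineq]) (simp add: norm_mult)
  ultimately show ?thesis using 1
    unfolding z_def[symmetric] by (simp add: algebra_simps)
qed


section \<open>Characteristic functions of renewal rewards\<close>

text \<open>\<open>\<Omega> k\<close> holds the blocks of size \<open>k\<close>, with weights
  \<open>w\<close> and centred rewards \<open>W\<close>; centring is required only over all sizes
  together. \<open>r t n\<close> plays the role of the unnormalised characteristic function of the
  total reward over length \<open>n\<close>.\<close>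

locale renewal_reward = renewal f u c for f u :: "nat \<Rightarrow> real" and c +
  fixes \<Omega> :: "nat \<Rightarrow> 'b set" and w W :: "nat \<Rightarrow> 'b \<Rightarrow> real" and r :: "real \<Rightarrow> nat \<Rightarrow> complex"
  assumes finite_\<Omega>: "finite (\<Omega> k)"
    and w_nonneg: "x \<in> \<Omega> k \<Longrightarrow> w k x \<ge> 0"
    and f_eq: "f k = (\<Sum>x\<in>\<Omega> k. w k x)"
    and W_le: "x \<in> \<Omega> k \<Longrightarrow> \<bar>W k x\<bar> \<le> real k"
    and W_mean: "(\<lambda>k. \<Sum>x\<in>\<Omega> k. w k x * W k x) sums 0"
    and r_rec: "r t n = (if n = 0 then 1 else 0)
      + (\<Sum>k\<le>n. (\<Sum>x\<in>\<Omega> k. of_real (w k x) * cis (t * W k x)) * r t (n - k))"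
begin

definition F :: "real \<Rightarrow> nat \<Rightarrow> complex" where
  "F t k = (\<Sum>x\<in>\<Omega> k. of_real (w k x) * cis (t * W k x))"

text \<open>The variance of the reward of a random block, as \<open>f\<close> has mass one and the
  mean reward is zero.\<close>

definition V :: real where "V = (\<Sum>k. \<Sum>x\<in>\<Omega> k. w k x * (W k x)\<^sup>2)"

lemma norm_sum_w_le:
  assumes "\<And>x. x \<in> \<Omega> k \<Longrightarrow> norm (g x) \<le> b"
  shows "norm (\<Sum>x\<in>\<Omega> k. of_real (w k x) * (g x :: complex)) \<le> f k * b"
proof -
  have "norm (\<Sum>x\<in>\<Omega> k. of_real (w k x) * g x) \<le> (\<Sum>x\<in>\<Omega> k. w k x * b)"
    using assms w_nonneg by (intro sum_norm_le) (simp add: norm_mult mult_left_mono)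
  then show ?thesis by (simp add: f_eq sum_distrib_right)
qed

lemma norm_F_le: "norm (F t k) \<le> f k"
  using norm_sum_w_le[of k "\<lambda>x. cis (t * W k x)" 1] by (simp add: F_def)

lemma F_0 [simp]: "F t 0 = 0"
  using norm_F_le[of t 0] by simp

lemma norm_cis_minus_1: "norm (cis y - 1) \<le> \<bar>y\<bar>"
  using iexp_approx1[of y 0] by (simp add: cis_conv_exp)

text \<open>Rewards are bounded by the block size, so \<open>F\<close> is Lipschitz in
  \<open>t\<close>, with constants \<open>k * f k\<close> that are summable over
  \<open>k\<close>.\<close>

lemma norm_F_diff: "norm (F t k - of_real (f k)) \<le> \<bar>t\<bar> * (real k * f k)"
proof -
  have "F t k - of_real (f k) = (\<Sum>x\<in>\<Omega> k. of_real (w k x) * (cis (t * W k x) - 1))"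
    by (simp add: F_def f_eq sum_subtractf algebra_simps)
  also have "norm \<dots> \<le> f k * (\<bar>t\<bar> * real k)"
  proof (rule norm_sum_w_le)
    fix x assume "x \<in> \<Omega> k"
    then have "\<bar>t * W k x\<bar> \<le> \<bar>t\<bar> * real k"
      by (simp add: abs_mult W_le mult_left_mono)
    then show "norm (cis (t * W k x) - 1) \<le> \<bar>t\<bar> * real k"
      using norm_cis_minus_1 order_trans by blast
  qed
  finally show ?thesis by (simp add: mult_ac)
qed

lemma norm_r_le: "norm (r t n) \<le> u n"
proof (induction n rule: less_induct)
  case (less n)
  have "norm (r t n) \<le> norm (if n = 0 then 1 else 0 :: complex) + norm (\<Sum>k\<le>n. F t k * r t (n - k))"
    unfolding r_rec[of t n, folded F_def] by (rule norm_triangle_ineq)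
  also have "norm (\<Sum>k\<le>n. F t k * r t (n - k)) \<le> (\<Sum>k\<le>n. f k * u (n - k))"
  proof (rule sum_norm_le)
    fix k assume "k \<in> {..n}"
    show "norm (F t k * r t (n - k)) \<le> f k * u (n - k)"
    \<comment> \<open>The term \<open>k = 0\<close> would involve \<open>r t n\<close> itself,
      outside the induction hypothesis; it vanishes since \<open>F t 0 = 0\<close>.\<close>
    proof (cases "k = 0")
      case False
      with \<open>k \<in> {..n}\<close> show ?thesis
        by (simp add: norm_mult mult_mono norm_F_le less f_nonneg)
    qed simp
  qed
  finally show ?case using u_rec[of n] by (cases "n = 0") simp_all
qed

lemma norm_r_le_1: "norm (r t n) \<le> 1"
  using norm_r_le u_le_1 order_trans by blast

lemma fps_r_mult: "Abs_fps (r t) * (1 - Abs_fps (F t)) = 1"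
proof -
  have "Abs_fps (r t) = 1 + Abs_fps (F t) * Abs_fps (r t)"
  proof (rule fps_ext)
    fix n show "fps_nth (Abs_fps (r t)) n = fps_nth (1 + Abs_fps (F t) * Abs_fps (r t)) n"
      using r_rec[of t n, folded F_def] by (simp add: fps_mult_nth atLeast0AtMost)
  qed
  then show ?thesis by (simp add: algebra_simps)
qed

text \<open>With \<open>D = (1 - X) U\<close> one has \<open>(1 - X) R = D + D (F\<^sub>t - F\<^sub>0) R\<close>, so the increments of \<open>r\<close> are
  small because \<open>D\<close> is absolutely summable and \<open>F\<^sub>t - F\<^sub>0\<close> is of order \<open>t\<close>.\<close>

lemma r_increment:
  assumes "n > 0"
  shows "norm (r t n - r t (n - 1)) \<le> norm (du n) + suminf (\<lambda>i. norm (du i)) / c * \<bar>t\<bar>"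
proof -
  let ?R = "Abs_fps (r t)" and ?D = "Abs_fps (\<lambda>n. complex_of_real (du n))"
    and ?F = "Abs_fps (F t)" and ?f = "Abs_fps (\<lambda>n. complex_of_real (f n))"
    and ?U = "Abs_fps (\<lambda>n. complex_of_real (u n))"
  have "?U = 1 + ?f * ?U"
  proof (rule fps_ext)
    fix n show "fps_nth ?U n = fps_nth (1 + ?f * ?U) n"
      using arg_cong[OF u_rec[of n], of complex_of_real] by (simp add: fps_mult_nth atLeast0AtMost)
  qed
  then have U: "?U * (1 - ?f) = 1" by (simp add: algebra_simps)
  have D: "(1 - fps_X) * ?U = ?D"
    by (rule fps_ext) (simp add: du_def algebra_simps)
  have "?U + ?U * (?F - ?f) * ?R = ?U * (?R * (1 - ?F)) + ?U * (?F - ?f) * ?R"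
    by (simp only: fps_r_mult mult_1_right)
  also have "\<dots> = (?U * (1 - ?f)) * ?R" by (simp add: algebra_simps)
  also have "\<dots> = ?R" by (simp only: U mult_1_left)
  finally have "(1 - fps_X) * (?U + ?U * (?F - ?f) * ?R) = (1 - fps_X) * ?R"
    by (simp only:)
  then have "(1 - fps_X) * ?R = ?D + ?D * ((?F - ?f) * ?R)"
    by (simp only: distrib_left mult.assoc[symmetric] D)
  moreover have "fps_nth ((1 - fps_X) * ?R) n = r t n - r t (n - 1)"
    using assms by (simp add: left_diff_distrib)
  moreover have "fps_nth (?D + ?D * ((?F - ?f) * ?R)) n = of_real (du n) + (\<Sum>i\<le>n. of_real (du i) *
      (\<Sum>k\<le>n - i. (F t k - of_real (f k)) * r t (n - i - k)))"
    by (simp add: fps_mult_nth atLeast0AtMost)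
  ultimately have "r t n - r t (n - 1) = of_real (du n) + (\<Sum>i\<le>n. of_real (du i) *
      (\<Sum>k\<le>n - i. (F t k - of_real (f k)) * r t (n - i - k)))"
    by simp
  also have "norm \<dots> \<le> norm (du n) + (\<Sum>i\<le>n. norm (du i) * (\<bar>t\<bar> * (1 / c)))"
  proof (intro order_trans[OF norm_triangle_ineq] add_mono sum_norm_le)
    fix i assume "i \<in> {..n}"
    have "norm (\<Sum>k\<le>n - i. (F t k - of_real (f k)) * r t (n - i - k)) \<le> (\<Sum>k\<le>n - i. \<bar>t\<bar> * (real k * f k) * 1)"
    proof (rule sum_norm_le)
      fix k
      show "norm ((F t k - of_real (f k)) * r t (n - i - k)) \<le> \<bar>t\<bar> * (real k * f k) * 1"
        unfolding norm_mult by (rule mult_mono[OF norm_F_diff norm_r_le_1]) (auto simp: f_nonneg)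
    qed
    also have "\<dots> = \<bar>t\<bar> * (\<Sum>k\<le>n - i. real k * f k)" by (simp add: sum_distrib_left)
    also have "\<dots> \<le> \<bar>t\<bar> * (1 / c)"
      using f_moment1 by (intro mult_left_mono)
        (auto simp: sums_iff f_nonneg intro!: sum_le_suminf[where f = "\<lambda>k. real k * f k", THEN order_trans])
    finally show "norm (complex_of_real (du i) * (\<Sum>k\<le>n - i. (F t k - of_real (f k)) * r t (n - i - k)))
        \<le> norm (du i) * (\<bar>t\<bar> * (1 / c))"
      unfolding norm_mult norm_of_real real_norm_def by (rule mult_left_mono) simp
  qed simp
  also have "(\<Sum>i\<le>n. norm (du i) * (\<bar>t\<bar> * (1 / c))) = (\<Sum>i\<le>n. norm (du i)) * (\<bar>t\<bar> * (1 / c))"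
    by (rule sum_distrib_right[symmetric])
  also have "\<dots> \<le> suminf (\<lambda>i. norm (du i)) * (\<bar>t\<bar> * (1 / c))"
    using c_pos by (intro mult_right_mono sum_le_suminf summable_norm_du) auto
  finally show ?thesis by simp
qed

text \<open>A shift by a fixed \<open>m\<close> is a sum of \<open>m\<close> increments. Each is
  controlled by \<open>r_increment\<close>, whose two terms vanish because \<open>du\<close> tends
  to \<open>0\<close> and the frequency is \<open>\<theta> / sqrt n\<close>.\<close>

lemma r_shift_limit: "(\<lambda>n. r (\<theta> / sqrt n) (n - m) - r (\<theta> / sqrt n) n) \<longlonglongrightarrow> 0"
proof (induction m)
  case (Suc m)
  let ?d = "\<lambda>n. r (\<theta> / sqrt (real n)) (n - m) - r (\<theta> / sqrt n) (n - m - 1)"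
  have "?d \<longlonglongrightarrow> 0"
  proof (rule Lim_null_comparison)
    show "\<forall>\<^sub>F n in sequentially. norm (?d n) \<le> norm (du (n - m)) + suminf (\<lambda>i. norm (du i)) / c * \<bar>\<theta> / sqrt n\<bar>"
      using eventually_gt_at_top[of m] by eventually_elim (intro r_increment, simp)
    have 1: "(\<lambda>n. \<theta> / sqrt (real n)) \<longlonglongrightarrow> 0"
      by (rule lim_const_over_sqrt)
    have 2: "(\<lambda>n. du (n - m)) \<longlonglongrightarrow> 0"
      by (rule filterlim_compose[OF summable_LIMSEQ_zero[OF sums_summable[OF du_sums]]])
        (rule filterlim_minus_const_nat_at_top)
    show "(\<lambda>n. norm (du (n - m)) + suminf (\<lambda>i. norm (du i)) / c * \<bar>\<theta> / sqrt n\<bar>) \<longlonglongrightarrow> 0"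
      using tendsto_add[OF tendsto_norm[OF 2] tendsto_mult_left[OF tendsto_rabs[OF 1], of "suminf (\<lambda>i. norm (du i)) / c"]]
      by simp
  qed
  from tendsto_diff[OF Suc this] show ?case by simp
qed simp

section \<open>The tilted kernel and its total mass\<close>

text \<open>\<open>F\<close> tilted by \<open>exp (b * k / n)\<close> with
  \<open>b = V * c * \<theta>\<^sup>2 / 2\<close>. Passing to frequency
  \<open>\<theta> / sqrt n\<close> costs mass \<open>V * \<theta>\<^sup>2 / (2 * n)\<close> to
  leading order; the tilt restores it because the mean block size is \<open>1 / c\<close>.\<close>

definition K :: "real \<Rightarrow> nat \<Rightarrow> nat \<Rightarrow> complex" where
  "K \<theta> n k = (\<Sum>x\<in>\<Omega> k. of_real (w k x) *
     exp (\<i> * of_real (\<theta> / sqrt n * W k x) + of_real (V * c / 2 * \<theta>\<^sup>2 * k / n)))"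

lemma K_eq: "K \<theta> n k = F (\<theta> / sqrt n) k * exp (of_real (V * c / 2 * \<theta>\<^sup>2 * k / n))"
  by (simp add: K_def F_def sum_distrib_right cis_conv_exp exp_add mult_ac)

lemma W2_le: "x \<in> \<Omega> k \<Longrightarrow> (W k x)\<^sup>2 \<le> (real k)\<^sup>2"
  using W_le[of x k] abs_le_square_iff[of "W k x" "real k"] by simp

lemma summable_V: "summable (\<lambda>k. \<Sum>x\<in>\<Omega> k. w k x * (W k x)\<^sup>2)"
proof (rule summable_comparison_test')
  show "summable (\<lambda>k. (real k)\<^sup>2 * f k)" by (rule f_moment2)
  fix k :: nat
  have "(\<Sum>x\<in>\<Omega> k. w k x * (W k x)\<^sup>2) \<le> (\<Sum>x\<in>\<Omega> k. w k x * (real k)\<^sup>2)"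
    by (intro sum_mono mult_left_mono W2_le w_nonneg)
  moreover have "(\<Sum>x\<in>\<Omega> k. w k x * (W k x)\<^sup>2) \<ge> 0"
    by (intro sum_nonneg mult_nonneg_nonneg w_nonneg) auto
  ultimately show "norm (\<Sum>x\<in>\<Omega> k. w k x * (W k x)\<^sup>2) \<le> (real k)\<^sup>2 * f k"
    by (simp add: f_eq sum_distrib_right mult_ac)
qed

lemma V_ge:
  assumes "finite A"
  shows "V \<ge> (\<Sum>k\<in>A. \<Sum>x\<in>\<Omega> k. w k x * (W k x)\<^sup>2)"
  unfolding V_def by (intro sum_le_suminf summable_V assms)
    (auto intro!: sum_nonneg mult_nonneg_nonneg w_nonneg)

lemma V_nonneg: "V \<ge> 0"
  using V_ge[of "{}"] by simp

lemma norm_K_le: "k \<le> n \<Longrightarrow> norm (K \<theta> n k) \<le> f k * exp (V * c / 2 * \<theta>\<^sup>2)"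
proof -
  assume kn: "k \<le> n"
  have "V * c / 2 * \<theta>\<^sup>2 * (k / n) \<le> V * c / 2 * \<theta>\<^sup>2 * 1"
    using kn V_nonneg c_pos by (intro mult_left_mono) (auto simp: divide_le_eq)
  then show ?thesis
    unfolding K_def by (intro norm_sum_w_le) simp
qed

lemma K_limit: "(\<lambda>n. K \<theta> n k) \<longlonglongrightarrow> of_real (f k)"
proof -
  have "(\<lambda>n. K \<theta> n k) \<longlonglongrightarrow> (\<Sum>x\<in>\<Omega> k. of_real (w k x) * exp (\<i> * of_real (0 * W k x) + of_real 0))"
    unfolding K_def
    by (intro tendsto_intros lim_const_over_n lim_const_over_sqrt)
  then show ?thesis by (simp add: f_eq)
qed

text \<open>After subtracting \<open>f k\<close> and the linear phase, whose series over
  \<open>k\<close> are \<open>1\<close> and \<open>0\<close>, the terms scaled by \<open>n\<close>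
  converge to \<open>b * k * f k - \<theta>\<^sup>2 / 2 * m2 k\<close>. Dominated convergence
  permits summation, and the total \<open>b / c - \<theta>\<^sup>2 / 2 * V\<close> is
  \<open>0\<close> by the choice of \<open>b\<close>.\<close>

lemma K_sum_limit: "(\<lambda>n. of_nat n * (1 - (\<Sum>k\<le>n. K \<theta> n k))) \<longlonglongrightarrow> 0"
proof -
  define b where "b = V * c / 2 * \<theta>\<^sup>2"
  have b: "b \<ge> 0" using V_nonneg c_pos by (simp add: b_def)
  define m1 where "m1 k = (\<Sum>x\<in>\<Omega> k. w k x * W k x)" for k
  define m2 where "m2 k = (\<Sum>x\<in>\<Omega> k. w k x * (W k x)\<^sup>2)" for k
  define a where "a k n = of_nat n * ((if k \<le> n then K \<theta> n k else 0) - of_real (f k)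
    - \<i> * of_real (\<theta> / sqrt (real n)) * of_real (m1 k))" for k n
  define C where "C = exp b * (\<bar>\<theta>\<bar> + b)\<^sup>2 + b"
  define C' where "C' = max C (1 + \<bar>\<theta>\<bar>)"
  have a_eq: "a k n = (\<Sum>x\<in>\<Omega> k. of_real (w k x) * (of_nat n * (exp (\<i> * of_real (\<theta> / sqrt n * W k x)
      + of_real (b * k / n)) - 1 - \<i> * of_real (\<theta> / sqrt n * W k x))))" if "k \<le> n" for k n
    using that by (simp add: a_def K_def b_def m1_def f_eq sum_subtractf sum.distrib sum_distrib_left algebra_simps)
  have lim: "(\<lambda>n. a k n) \<longlonglongrightarrow> of_real (b * (k * f k) - \<theta>\<^sup>2 / 2 * m2 k)" for k
  proof -
    have "(\<lambda>n. \<Sum>x\<in>\<Omega> k. of_real (w k x) * (of_nat n * (exp (\<i> * of_real (\<theta> * W k x / sqrt n)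
      + of_real (b * k / n)) - 1 - \<i> * of_real (\<theta> * W k x / sqrt n))))
      \<longlonglongrightarrow> (\<Sum>x\<in>\<Omega> k. of_real (w k x) * of_real (b * k - (\<theta> * W k x)\<^sup>2 / 2))"
      by (intro tendsto_sum tendsto_mult tendsto_const exp_second_order_limit)
    also have "(\<Sum>x\<in>\<Omega> k. of_real (w k x) * of_real (b * k - (\<theta> * W k x)\<^sup>2 / 2))
        = (of_real (b * (k * f k) - \<theta>\<^sup>2 / 2 * m2 k) :: complex)"
      by (simp add: f_eq m2_def sum_subtractf sum_distrib_left algebra_simps)
    finally show ?thesis
      by (rule Lim_transform_eventually)
        (use eventually_ge_at_top[of k] in eventually_elim, simp add: a_eq)
  qed
  have bound: "norm (a k n) \<le> C' * ((real k)\<^sup>2 * f k)" if "n > 0" for k n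
  proof (cases "k \<le> n")
    case True
    have "norm (a k n) \<le> f k * (C * (real k)\<^sup>2)"
      unfolding a_eq[OF True] C_def
      by (intro norm_sum_w_le exp_second_order_bound b True that W_le)
    also have "\<dots> = C * ((real k)\<^sup>2 * f k)" by (simp add: mult_ac)
    also have "\<dots> \<le> C' * ((real k)\<^sup>2 * f k)"
      unfolding C'_def by (intro mult_right_mono) (auto simp: f_nonneg)
    finally show ?thesis .
  next
    case False
    \<comment> \<open>Beyond the truncation only the subtracted terms remain; \<open>n < k\<close>
      bounds the factors \<open>n\<close> and \<open>sqrt n\<close> by powers of
      \<open>k\<close>.\<close>
    have m1: "\<bar>m1 k\<bar> \<le> f k * k"
      unfolding m1_def f_eq sum_distrib_right
      by (intro order_trans[OF sum_abs] sum_mono) (simp add: abs_mult w_nonneg W_le mult_left_mono)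
    have "a k n = - (of_real (real n * f k) + \<i> * of_real (real n * (\<theta> / sqrt n) * m1 k))"
      using False by (simp add: a_def algebra_simps)
    then have "norm (a k n) \<le> norm (complex_of_real (real n * f k)) + norm (\<i> * complex_of_real (real n * (\<theta> / sqrt n) * m1 k))"
      by (simp only: norm_minus_cancel norm_triangle_ineq)
    also have "\<dots> = real n * f k + (sqrt n * \<bar>\<theta>\<bar>) * \<bar>m1 k\<bar>"
    proof -
      have "real n * \<bar>\<theta> / sqrt n\<bar> = (real n / sqrt n) * \<bar>\<theta>\<bar>" by simp
      then have "real n * \<bar>\<theta> / sqrt n\<bar> = sqrt n * \<bar>\<theta>\<bar>" by (simp only: real_div_sqrt of_nat_0_le_iff)
      then show ?thesis
        by (simp only: norm_mult norm_of_real norm_ii abs_mult) (simp add: f_nonneg)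
    qed
    also have "\<dots> \<le> (real k)\<^sup>2 * f k + (real k * \<bar>\<theta>\<bar>) * (f k * k)"
    proof (intro add_mono mult_mono mult_right_mono m1 f_nonneg)
      have "real n \<le> real k * 1" using False by simp
      also have "\<dots> \<le> real k * real k" using False that by (intro mult_left_mono) auto
      finally show "real n \<le> (real k)\<^sup>2" by (simp add: power2_eq_square)
      then show "sqrt n \<le> real k" by (simp add: real_le_lsqrt)
    qed (auto simp: f_nonneg)
    also have "\<dots> = (1 + \<bar>\<theta>\<bar>) * ((real k)\<^sup>2 * f k)"
      by (simp add: algebra_simps power2_eq_square)
    also have "\<dots> \<le> C' * ((real k)\<^sup>2 * f k)"
      unfolding C'_def by (intro mult_right_mono) (auto simp: f_nonneg)
    finally show ?thesis .
  qed
  have "(\<lambda>n. \<Sum>k. a k n) \<longlonglongrightarrow> (\<Sum>k. of_real (b * (k * f k) - \<theta>\<^sup>2 / 2 * m2 k))"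
    by (rule tannery_sequentially[OF lim bound]) (auto intro: summable_mult f_moment2)
  moreover have "(\<lambda>k. complex_of_real (b * (k * f k) - \<theta>\<^sup>2 / 2 * m2 k)) sums of_real (b * (1 / c) - \<theta>\<^sup>2 / 2 * V)"
    using summable_V unfolding V_def m2_def
    by (intro sums_of_real sums_diff sums_mult f_moment1 summable_sums)
  then have "(\<lambda>k. complex_of_real (b * (k * f k) - \<theta>\<^sup>2 / 2 * m2 k)) sums 0"
    using c_pos by (simp add: b_def)
  ultimately have "(\<lambda>n. \<Sum>k. a k n) \<longlonglongrightarrow> 0"
    by (simp add: sums_iff)
  moreover have "(\<Sum>k. a k n) = - (of_nat n * (1 - (\<Sum>k\<le>n. K \<theta> n k)))" for n
  proof -
    have "(\<lambda>k. if k \<le> n then K \<theta> n k else 0) sums (\<Sum>k\<le>n. K \<theta> n k)"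
      using sums_If_finite_set[of "{..n}" "K \<theta> n"] by simp
    then have "(\<lambda>k. a k n) sums (of_nat n * ((\<Sum>k\<le>n. K \<theta> n k) - of_real 1
        - \<i> * of_real (\<theta> / sqrt (real n)) * of_real 0))"
      unfolding a_def using W_mean[folded m1_def] f_sums
      by (intro sums_mult sums_diff sums_of_real)
    then show ?thesis by (simp add: sums_iff algebra_simps)
  qed
  ultimately have "(\<lambda>n. - (of_nat n * (1 - (\<Sum>k\<le>n. K \<theta> n k)))) \<longlonglongrightarrow> 0" by simp
  then show ?thesis using tendsto_minus by fastforce
qed

text \<open>\<open>r\<close> is compared with \<open>g\<^sub>m = c exp (- b m / n)\<close>, which solves the renewal equation up to the defect
  \<open>\<eta>\<close>; convolving \<open>\<eta>\<close> with \<open>r\<close> recovers \<open>r - g\<close>. Truncating \<open>K\<close> at \<open>n\<close> splits \<open>\<eta>\<close> into a total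
  defect of order \<open>o(1/n)\<close> and tails that are summable uniformly in \<open>n\<close>.\<close>

lemma r_minus_g:
  fixes \<theta> n
  assumes "n > 0"
  defines "b \<equiv> V * c / 2 * \<theta>\<^sup>2"
  shows "r (\<theta> / sqrt n) n - of_real (c * exp (- b))
    = (r (\<theta> / sqrt n) n - of_real c * (\<Sum>m\<le>n. r (\<theta> / sqrt n) (n - m) *
          (of_real (exp (- b * m / n)) * (\<Sum>k\<in>{m<..n}. K \<theta> n k))))
      - of_real c * (\<Sum>m\<le>n. r (\<theta> / sqrt n) (n - m) * of_real (exp (- b * m / n))) * (1 - (\<Sum>k\<le>n. K \<theta> n k))"
proof -
  define t where "t = \<theta> / sqrt (real n)"
  define g where "g m = complex_of_real (c * exp (- b * m / n))" for m :: nat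
  let ?R = "Abs_fps (r t)" and ?F = "Abs_fps (F t)" and ?G = "Abs_fps g"
  define E where "E = 1 - (\<Sum>k\<le>n. K \<theta> n k)"
  define T where "T m = (\<Sum>k\<in>{m<..n}. K \<theta> n k)" for m
  have "?R - ?G = ?R - ?R * (1 - ?F) * ?G" by (simp only: fps_r_mult mult_1_left)
  also have "\<dots> = (1 - (1 - ?F) * ?G) * ?R" by (simp add: algebra_simps)
  finally have eq: "?R - ?G = (1 - (1 - ?F) * ?G) * ?R" .
  have eta: "fps_nth (1 - (1 - ?F) * ?G) m = (if m = 0 then 1 else 0) - g m * E - g m * T m" if "m \<le> n" for m
  proof -
    have "fps_nth (1 - (1 - ?F) * ?G) m = (if m = 0 then 1 else 0) - (g m - (\<Sum>k\<le>m. F t k * g (m - k)))"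
      by (simp add: left_diff_distrib fps_mult_nth atLeast0AtMost)
    \<comment> \<open>Shifting \<open>g\<close> back by \<open>k\<close> multiplies it by
      \<open>exp (b * k / n)\<close>, the tilt contained in \<open>K\<close>.\<close>
    also have "(\<Sum>k\<le>m. F t k * g (m - k)) = (\<Sum>k\<le>m. g m * K \<theta> n k)"
    proof (rule sum.cong)
      fix k assume "k \<in> {..m}"
      then have "- b * real (m - k) / n = - b * m / n + b * k / n"
        by (simp add: of_nat_diff diff_divide_distrib add_divide_distrib algebra_simps)
      then show "F t k * g (m - k) = g m * K \<theta> n k"
        unfolding g_def K_eq t_def b_def[symmetric]
        by (simp only: exp_add of_real_mult exp_of_real) (simp add: mult_ac)
    qed simp
    also have "\<dots> = g m * ((\<Sum>k\<le>n. K \<theta> n k) - T m)"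
    proof -
      have "{..n} = {..m} \<union> {m<..n}" using that by auto
      then have "(\<Sum>k\<le>n. K \<theta> n k) = (\<Sum>k\<le>m. K \<theta> n k) + T m"
        unfolding T_def by (simp only:) (rule sum.union_disjoint, auto)
      then show ?thesis by (simp add: sum_distrib_left)
    qed
    finally show ?thesis by (simp add: E_def algebra_simps)
  qed
  have "r t n - g n = fps_nth ((1 - (1 - ?F) * ?G) * ?R) n"
    using arg_cong[OF eq, of "\<lambda>h. fps_nth h n"] by simp
  also have "\<dots> = (\<Sum>m\<le>n. ((if m = 0 then 1 else 0) - g m * E - g m * T m) * r t (n - m))"
    unfolding fps_mult_nth atLeast0AtMost by (intro sum.cong) (auto simp only: eta atMost_iff fps_nth_Abs_fps)
  also have "\<dots> = (\<Sum>m\<le>n. if m = 0 then r t (n - m) else 0) - (\<Sum>m\<le>n. r t (n - m) * g m) * E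
      - (\<Sum>m\<le>n. r t (n - m) * (g m * T m))"
  proof -
    have "((if m = 0 then 1 else 0) - g m * E - g m * T m) * r t (n - m)
        = (if m = 0 then r t (n - m) else 0) - (r t (n - m) * g m) * E - r t (n - m) * (g m * T m)" for m
      by (simp add: algebra_simps)
    then show ?thesis by (simp only: sum_subtractf sum_distrib_right)
  qed
  also have "(\<Sum>m\<le>n. if m = 0 then r t (n - m) else 0) = r t n" by simp
  finally have "r t n - g n = r t n - (\<Sum>m\<le>n. r t (n - m) * g m) * E - (\<Sum>m\<le>n. r t (n - m) * (g m * T m))" .
  then show ?thesis
    using assms(1) unfolding t_def[symmetric] E_def T_def
    by (simp add: g_def sum_distrib_left mult_ac)
qed

lemma sum_H_tail: "(\<lambda>k. if m < k then f k else 0) sums H m"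
proof -
  have "(\<lambda>k. f k - (if k \<in> {..m} then f k else 0)) sums (1 - (\<Sum>k\<le>m. f k))"
    by (intro sums_diff f_sums sums_If_finite_set) simp
  also have "(\<lambda>k. f k - (if k \<in> {..m} then f k else 0)) = (\<lambda>k. if m < k then f k else 0)"
    by auto
  finally show ?thesis by (simp add: H_def)
qed

lemma K_tail_limit: "(\<lambda>n. \<Sum>k\<in>{m<..n}. K \<theta> n k) \<longlonglongrightarrow> of_real (H m)"
proof -
  define L where "L = exp (V * c / 2 * \<theta>\<^sup>2)"
  define a where "a k n = (if m < k \<and> k \<le> n then K \<theta> n k else 0)" for k n
  have "(\<lambda>n. \<Sum>k. a k n) \<longlonglongrightarrow> (\<Sum>k. of_real (if m < k then f k else 0))"
  proof (rule tannery_sequentially)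
    show "(\<lambda>n. a k n) \<longlonglongrightarrow> of_real (if m < k then f k else 0)" for k
    proof (rule Lim_transform_eventually)
      show "(\<lambda>n. if m < k then K \<theta> n k else 0) \<longlonglongrightarrow> of_real (if m < k then f k else 0)"
        using K_limit by simp
      show "\<forall>\<^sub>F n in sequentially. (if m < k then K \<theta> n k else 0) = a k n"
        using eventually_ge_at_top[of k] by eventually_elim (simp add: a_def)
    qed
    show "norm (a k n) \<le> f k * L" for k n
      using norm_K_le[of k n \<theta>] by (auto simp: a_def L_def f_nonneg)
    show "summable (\<lambda>k. f k * L)"
      using f_sums by (intro summable_mult2) (simp add: sums_iff)
  qed
  moreover have "(\<Sum>k. a k n) = (\<Sum>k\<in>{m<..n}. K \<theta> n k)" for n
    using sums_If_finite_set[of "{m<..n}" "K \<theta> n"] by (simp add: a_def sums_iff)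
  moreover have "(\<Sum>k. complex_of_real (if m < k then f k else 0)) = of_real (H m)"
    using sums_of_real[OF sum_H_tail, of m, where ?'a = complex] by (simp add: sums_iff)
  ultimately show ?thesis by simp
qed

lemma norm_K_tail_le: "norm (\<Sum>k\<in>{m<..n}. K \<theta> n k) \<le> H m * exp (V * c / 2 * \<theta>\<^sup>2)"
proof -
  have "norm (\<Sum>k\<in>{m<..n}. K \<theta> n k) \<le> (\<Sum>k\<in>{m<..n}. f k * exp (V * c / 2 * \<theta>\<^sup>2))"
    by (intro sum_norm_le norm_K_le) simp
  also have "\<dots> = (\<Sum>k\<in>{m<..n}. if m < k then f k else 0) * exp (V * c / 2 * \<theta>\<^sup>2)"
    unfolding sum_distrib_right by (intro sum.cong) auto
  also have "\<dots> \<le> H m * exp (V * c / 2 * \<theta>\<^sup>2)"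
    using sum_H_tail[of m]
    by (intro mult_right_mono order_trans[OF sum_le_suminf[where f = "\<lambda>k. if m < k then f k else 0"]])
      (auto simp: sums_iff f_nonneg)
  finally show ?thesis .
qed

text \<open>In \<open>r_minus_g\<close>, \<open>r\<close> at \<open>n - m\<close> may be replaced by
  \<open>r\<close> at \<open>n\<close> (fact \<open>B\<close>), and the weights then sum to
  \<open>c * (1 / c) = 1\<close> in the limit (facts \<open>A\<close> and \<open>C\<close>). So
  \<open>r\<close> cancels from the right-hand side and only the defect \<open>E\<close> is left,
  which is \<open>o(1 / n)\<close> against \<open>n + 1\<close> bounded summands (fact
  \<open>D\<close>).\<close>

theorem r_limit: "(\<lambda>n. r (\<theta> / sqrt n) n) \<longlonglongrightarrow> of_real (c * exp (- (V * c / 2 * \<theta>\<^sup>2)))"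
proof -
  define b where "b = V * c / 2 * \<theta>\<^sup>2"
  have b: "b \<ge> 0" using V_nonneg c_pos by (simp add: b_def)
  define R where "R n m = r (\<theta> / sqrt (real n)) m" for n m
  define l where "l n m = complex_of_real (exp (- b * m / n))" for n m :: nat
  define T where "T n m = (\<Sum>k\<in>{m<..n}. K \<theta> n k)" for n m
  define E where "E n = 1 - (\<Sum>k\<le>n. K \<theta> n k)" for n
  have norm_l: "norm (l n m) \<le> 1" for n m
    using b by (simp add: l_def)
  have norm_T: "norm (T n m) \<le> H m * exp b" for n m
    unfolding T_def b_def by (rule norm_K_tail_le)
  have norm_lT: "norm (l n m * T n m) \<le> H m * exp b" for n m
    using mult_mono[OF norm_l norm_T] by (simp add: norm_mult)
  have norm_R: "norm (R n m) \<le> 1" for n m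
    unfolding R_def by (rule norm_r_le_1)
  have sum_HL: "summable (\<lambda>m. H m * exp b)" by (intro summable_mult2 summable_H)
  have suminf_le: "(\<Sum>m. if m \<le> n then h m else 0) = (\<Sum>m\<le>n. h m)" for n and h :: "nat \<Rightarrow> complex"
    using sums_If_finite_set[of "{..n}" h] by (simp add: sums_iff)
  have l_lim: "(\<lambda>n. l n m) \<longlonglongrightarrow> 1" for m
  proof -
    have "(\<lambda>n. l n m) \<longlonglongrightarrow> of_real (exp 0)"
      unfolding l_def by (intro tendsto_intros lim_const_over_n)
    then show ?thesis by simp
  qed
  have lT_lim: "(\<lambda>n. l n m * T n m) \<longlonglongrightarrow> of_real (H m)" for m
    using tendsto_mult[OF l_lim K_tail_limit] by (simp add: T_def)
  have A: "(\<lambda>n. \<Sum>m\<le>n. l n m * T n m) \<longlonglongrightarrow> of_real (1 / c)"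
  proof -
    have "(\<lambda>n. \<Sum>m. if m \<le> n then l n m * T n m else 0) \<longlonglongrightarrow> (\<Sum>m. of_real (H m))"
    proof (rule tannery_sequentially[OF _ _ sum_HL])
      fix m
      show "(\<lambda>n. if m \<le> n then l n m * T n m else 0) \<longlonglongrightarrow> of_real (H m)"
        by (rule Lim_transform_eventually[OF lT_lim])
          (use eventually_ge_at_top[of m] in eventually_elim, simp)
      fix n show "norm (if m \<le> n then l n m * T n m else 0) \<le> H m * exp b"
        using norm_lT[of n m] H_nonneg[of m] by simp
    qed
    then show ?thesis
      using suminf_of_real[OF summable_H, where ?'a = complex] by (simp add: suminf_le suminf_H)
  qed
  have B: "(\<lambda>n. \<Sum>m\<le>n. (R n (n - m) - R n n) * (l n m * T n m)) \<longlonglongrightarrow> 0"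
  proof -
    have "(\<lambda>n. \<Sum>m. if m \<le> n then (R n (n - m) - R n n) * (l n m * T n m) else 0) \<longlonglongrightarrow> (\<Sum>m. 0)"
    proof (rule tannery_sequentially[OF _ _ summable_mult[OF sum_HL, of 2]])
      fix m
      have "(\<lambda>n. (R n (n - m) - R n n) * (l n m * T n m)) \<longlonglongrightarrow> 0 * of_real (H m)"
        unfolding R_def by (intro tendsto_mult r_shift_limit lT_lim)
      then have "(\<lambda>n. (R n (n - m) - R n n) * (l n m * T n m)) \<longlonglongrightarrow> 0" by simp
      then show "(\<lambda>n. if m \<le> n then (R n (n - m) - R n n) * (l n m * T n m) else 0) \<longlonglongrightarrow> 0"
        by (rule Lim_transform_eventually)
          (use eventually_ge_at_top[of m] in eventually_elim, simp)
      fix n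
      have "norm (R n (n - m) - R n n) \<le> 2"
        using norm_triangle_ineq4[of "R n (n - m)" "R n n"] norm_R[of n "n - m"] norm_R[of n n] by linarith
      then have "norm ((R n (n - m) - R n n) * (l n m * T n m)) \<le> 2 * (H m * exp b)"
        unfolding norm_mult[of "R n (n - m) - R n n"] by (intro mult_mono norm_lT) auto
      then show "norm (if m \<le> n then (R n (n - m) - R n n) * (l n m * T n m) else 0) \<le> 2 * (H m * exp b)"
        using H_nonneg[of m] by simp
    qed
    then show ?thesis by (simp add: suminf_le)
  qed
  have C: "(\<lambda>n. R n n * (1 - of_real c * (\<Sum>m\<le>n. l n m * T n m))) \<longlonglongrightarrow> 0"
  proof (rule Lim_null_comparison)
    show "\<forall>\<^sub>F n in sequentially. norm (R n n * (1 - of_real c * (\<Sum>m\<le>n. l n m * T n m)))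
        \<le> norm (1 - of_real c * (\<Sum>m\<le>n. l n m * T n m))"
      using norm_R by (intro always_eventually allI) (simp add: norm_mult mult_left_le_one_le)
    have "(\<lambda>n. norm (1 - of_real c * (\<Sum>m\<le>n. l n m * T n m))) \<longlonglongrightarrow> norm (1 - complex_of_real c * of_real (1 / c))"
      by (intro tendsto_intros A)
    then show "(\<lambda>n. norm (1 - of_real c * (\<Sum>m\<le>n. l n m * T n m))) \<longlonglongrightarrow> 0"
      using c_pos by simp
  qed
  have D: "(\<lambda>n. of_real c * (\<Sum>m\<le>n. R n (n - m) * l n m) * E n) \<longlonglongrightarrow> 0"
  proof (rule Lim_null_comparison)
    show "\<forall>\<^sub>F n in sequentially. norm (of_real c * (\<Sum>m\<le>n. R n (n - m) * l n m) * E n)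
        \<le> 2 * c * norm (of_nat n * E n)"
      using eventually_gt_at_top[of 0]
    proof eventually_elim
      case (elim n)
      have "norm (\<Sum>m\<le>n. R n (n - m) * l n m) \<le> (\<Sum>m\<le>n. 1)"
        using norm_R norm_l by (intro sum_norm_le) (simp add: norm_mult mult_le_one)
      also have "\<dots> \<le> 2 * real n" using elim by simp
      finally have "c * norm (\<Sum>m\<le>n. R n (n - m) * l n m) * norm (E n) \<le> c * (2 * real n) * norm (E n)"
        using c_pos by (intro mult_right_mono mult_left_mono) auto
      then show ?case using c_pos by (simp add: norm_mult mult_ac)
    qed
    show "(\<lambda>n. 2 * c * norm (of_nat n * E n)) \<longlonglongrightarrow> 0"
      using tendsto_mult_left[OF tendsto_norm[OF K_sum_limit], of "2 * c" \<theta>] by (simp add: E_def)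
  qed
  have "(\<lambda>n. (R n n * (1 - of_real c * (\<Sum>m\<le>n. l n m * T n m))
      - of_real c * (\<Sum>m\<le>n. (R n (n - m) - R n n) * (l n m * T n m)))
      - of_real c * (\<Sum>m\<le>n. R n (n - m) * l n m) * E n) \<longlonglongrightarrow> (0 - of_real c * 0) - 0"
    by (intro tendsto_diff tendsto_mult tendsto_const B C D)
  moreover have "\<forall>\<^sub>F n in sequentially. (R n n * (1 - of_real c * (\<Sum>m\<le>n. l n m * T n m))
      - of_real c * (\<Sum>m\<le>n. (R n (n - m) - R n n) * (l n m * T n m)))
      - of_real c * (\<Sum>m\<le>n. R n (n - m) * l n m) * E n = R n n - of_real (c * exp (- b))"
    using eventually_gt_at_top[of 0]
  proof eventually_elim
    case (elim n)
    have "R n n - of_real (c * exp (- b)) = (R n n - of_real c * (\<Sum>m\<le>n. R n (n - m) * (l n m * T n m)))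
       - of_real c * (\<Sum>m\<le>n. R n (n - m) * l n m) * E n"
      using r_minus_g[OF elim, of \<theta>] by (simp only: R_def l_def T_def E_def b_def)
    moreover have "R n n * (1 - of_real c * (\<Sum>m\<le>n. l n m * T n m))
      - of_real c * (\<Sum>m\<le>n. (R n (n - m) - R n n) * (l n m * T n m))
      = R n n - of_real c * (\<Sum>m\<le>n. R n (n - m) * (l n m * T n m))"
      by (simp add: left_diff_distrib sum_subtractf sum_distrib_left algebra_simps)
    ultimately show ?case by simp
  qed
  ultimately have "(\<lambda>n. R n n - of_real (c * exp (- b))) \<longlonglongrightarrow> 0"
    using Lim_transform_eventually by fastforce
  then show ?thesis unfolding R_def b_def by (simp add: LIM_zero_iff)
qed

end

section \<open>Pairs of Mallows permutations\<close>

text \<open>The power of \<open>(1 - q) * (1 - q')\<close> keeps the weight multiplicative over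
  direct sums and, for parameters in \<open>(0, 1)\<close>, makes the total weight converge to a
  positive limit.\<close>

definition pair_weight :: "real \<Rightarrow> real \<Rightarrow> nat \<Rightarrow> (nat \<Rightarrow> nat) \<times> (nat \<Rightarrow> nat) \<Rightarrow> real" where
  "pair_weight q q' n x =
     ((1 - q) * (1 - q')) ^ n * (q ^ inversion_number n (fst x) * q' ^ inversion_number n (snd x))"

definition pair_LCS :: "nat \<Rightarrow> (nat \<Rightarrow> nat) \<times> (nat \<Rightarrow> nat) \<Rightarrow> nat" where
  "pair_LCS n x = LCS n (fst x) (snd x)"

lemma pair_weight_psum2:
  assumes "x \<in> pairs k" "y \<in> pairs m"
  shows "pair_weight q q' (k + m) (psum2 k x y) = pair_weight q q' k x * pair_weight q q' m y"
  using assms unfolding pairs_def mem_Times_iff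
  by (simp add: pair_weight_def psum2_def inversion_number_psum power_add)

lemma pair_LCS_psum2:
  assumes "x \<in> pairs k" "y \<in> pairs m"
  shows "pair_LCS (k + m) (psum2 k x y) = pair_LCS k x + pair_LCS m y"
  using assms unfolding pairs_def mem_Times_iff
  by (simp add: pair_LCS_def psum2_def LCS_psum)

lemma pair_weight_0: "pair_weight q q' 0 (id, id) = 1"
proof -
  have "inversion_number 0 id = 0"
    unfolding inversion_number_def by (subst card_eq_0_iff) auto
  then show ?thesis by (simp add: pair_weight_def)
qed

lemma pair_LCS_le: "pair_LCS n x \<le> n"
  by (simp add: pair_LCS_def LCS_le)

lemma sum_pair_weight_eq_Z:
  "sum (pair_weight q q' n) (pairs n) = ((1 - q) * (1 - q')) ^ n * (mallows_Z n q * mallows_Z n q')"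
proof -
  have "sum (pair_weight q q' n) (pairs n) =
      (\<Sum>(p, t)\<in>perms n \<times> perms n. ((1 - q) * (1 - q')) ^ n * (q ^ inversion_number n p * q' ^ inversion_number n t))"
    unfolding pairs_def by (intro sum.cong) (auto simp: pair_weight_def)
  also have "\<dots> = ((1 - q) * (1 - q')) ^ n * (\<Sum>(p, t)\<in>perms n \<times> perms n. q ^ inversion_number n p * q' ^ inversion_number n t)"
    by (simp add: sum_distrib_left split_beta)
  also have "(\<Sum>(p, t)\<in>perms n \<times> perms n. q ^ inversion_number n p * q' ^ inversion_number n t)
      = mallows_Z n q * mallows_Z n q'"
    unfolding mallows_Z_def by (simp only: sum_product sum.cartesian_product)
  finally show ?thesis .
qed

lemma sum_pair_weight:
  "sum (pair_weight q q' n) (pairs n) = (\<Prod>i=1..n. 1 - q ^ i) * (\<Prod>i=1..n. 1 - q' ^ i)"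
  unfolding sum_pair_weight_eq_Z mallows_Z_prod[symmetric]
  by (simp add: power_mult_distrib mult_ac)

text \<open>Absolute convergence by the geometric series, together with nonvanishing factors,
  excludes the limit \<open>0\<close>; positivity of the partial products fixes the sign.\<close>

lemma euler_product_limit:
  fixes q :: real
  assumes "0 < q" "q < 1"
  shows "\<exists>d>0. (\<lambda>n. \<Prod>i=1..n. 1 - q ^ i) \<longlonglongrightarrow> d"
proof -
  let ?f = "\<lambda>i. 1 - q ^ Suc i"
  have pos: "?f i > 0" for i
    using assms power_Suc_less_one[of q i] by simp
  have "summable (\<lambda>i. norm (?f i - 1))"
    using assms by (simp add: summable_mult summable_geometric abs_mult power_abs)
  then have conv: "convergent_prod ?f"
    by (intro abs_convergent_prod_imp_convergent_prod) (simp only: abs_convergent_prod_conv_summable)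
  have lim: "(\<lambda>n. \<Prod>i\<le>n. ?f i) \<longlonglongrightarrow> prodinf ?f"
    by (rule convergent_prod_LIMSEQ[OF conv])
  have "prodinf ?f \<noteq> 0"
    using pos by (intro prodinf_nonzero[OF conv]) (metis less_irrefl)
  moreover have "prodinf ?f \<ge> 0"
  proof (rule LIMSEQ_le_const[OF lim])
    have "(\<Prod>i\<le>n. ?f i) \<ge> 0" for n by (intro prod_nonneg less_imp_le pos)
    then show "\<exists>N. \<forall>n\<ge>N. (\<Prod>i\<le>n. ?f i) \<ge> 0" by blast
  qed
  moreover have "(\<Prod>i\<le>n. ?f i) = (\<Prod>i=1..Suc n. 1 - q ^ i)" for n
    by (rule prod.reindex_bij_witness[of _ "\<lambda>i. i - 1" Suc]) auto
  then have "(\<lambda>n. \<Prod>i=1..n. 1 - q ^ i) \<longlonglongrightarrow> prodinf ?f"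
    using lim by (subst filterlim_sequentially_Suc[symmetric]) simp
  ultimately show ?thesis by (intro exI[of _ "prodinf ?f"]) auto
qed

text \<open>With \<open>x = q ^ Suc n\<close> and \<open>y = q' ^ Suc n\<close>, each step
  multiplies \<open>u\<close> by \<open>(1 - x) * (1 - y)\<close>, a loss of the fraction
  \<open>x + y - x * y\<close>. This lies between \<open>0\<close> and \<open>x + y\<close>, which
  gives monotonicity and a summable majorant for the weighted differences.\<close>

lemma mallows_renewal:
  fixes q q' :: real
  assumes q: "0 < q" "q < 1" and q': "0 < q'" "q' < 1"
  shows "\<exists>c. renewal (\<lambda>k. sum (pair_weight q q' k) (indec k)) (\<lambda>n. sum (pair_weight q q' n) (pairs n)) c"
proof -
  define u where "u n = sum (pair_weight q q' n) (pairs n)" for n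
  have u_eq: "u n = (\<Prod>i=1..n. 1 - q ^ i) * (\<Prod>i=1..n. 1 - q' ^ i)" for n
    unfolding u_def by (rule sum_pair_weight)
  obtain d d' where d: "d > 0" "(\<lambda>n. \<Prod>i=1..n. 1 - q ^ i) \<longlonglongrightarrow> d"
      "d' > 0" "(\<lambda>n. \<Prod>i=1..n. 1 - q' ^ i) \<longlonglongrightarrow> d'"
    using euler_product_limit[OF q] euler_product_limit[OF q'] by blast
  have w_nonneg: "pair_weight q q' n x \<ge> 0" for n x
    using assms by (simp add: pair_weight_def)
  have u_nonneg: "u n \<ge> 0" for n by (simp add: u_def sum_nonneg w_nonneg)
  have pow: "q ^ n \<le> 1" "q' ^ n \<le> 1" for n
    using assms by (simp_all add: power_le_one)
  have step: "u n - u (Suc n) = u n * (q ^ Suc n + q' ^ Suc n - q ^ Suc n * q' ^ Suc n)" for n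
    unfolding u_eq by (simp add: algebra_simps)
  have inner: "0 \<le> x + y - x * y" "x + y - x * y \<le> x + y" if "0 \<le> x" "x \<le> 1" "0 \<le> y" "y \<le> 1" for x y :: real
  proof -
    have "x * y \<le> 1 * y" using that by (intro mult_right_mono) auto
    then show "0 \<le> x + y - x * y" using that by linarith
    show "x + y - x * y \<le> x + y" using that by simp
  qed
  have step_nonneg: "u n - u (Suc n) \<ge> 0" for n
    unfolding step using assms pow[of "Suc n"] by (intro mult_nonneg_nonneg u_nonneg inner) auto
  then have dec: "decseq u" by (intro decseq_SucI) (simp add: algebra_simps)
  have u_le: "u n \<le> 1" for n
    using decseqD[OF dec, of 0 n] by (simp add: u_eq)
  have step_le: "u n - u (Suc n) \<le> q ^ Suc n + q' ^ Suc n" for n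
  proof -
    have "u n - u (Suc n) \<le> 1 * (q ^ Suc n + q' ^ Suc n)"
      unfolding step using assms pow[of "Suc n"] by (intro mult_mono u_le inner) auto
    then show ?thesis by simp
  qed
  have geo: "summable (\<lambda>n. real (Suc n) * x ^ Suc n)" if "0 < x" "x < 1" for x :: real
  proof -
    have "summable (\<lambda>n. x * (real (Suc n) * x ^ n))"
      using geometric_deriv_sums[of x] that by (intro summable_mult) (auto simp: sums_iff)
    then show ?thesis by (simp add: mult_ac)
  qed
  have "renewal (\<lambda>k. sum (pair_weight q q' k) (indec k)) u (d * d')"
  proof
    show "u n = (if n = 0 then 1 else 0) + (\<Sum>k\<le>n. sum (pair_weight q q' k) (indec k) * u (n - k))" for n
      unfolding u_def by (rule sum_pairs_renewal) (simp_all add: pair_weight_0 pair_weight_psum2)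
    show "u \<longlonglongrightarrow> d * d'" unfolding u_eq by (intro tendsto_mult d)
    show "summable (\<lambda>n. real (Suc n) * (u n - u (Suc n)))"
    proof (rule summable_comparison_test')
      show "summable (\<lambda>n. real (Suc n) * q ^ Suc n + real (Suc n) * q' ^ Suc n)"
        by (intro summable_add geo q q')
      fix n :: nat
      show "norm (real (Suc n) * (u n - u (Suc n))) \<le> real (Suc n) * q ^ Suc n + real (Suc n) * q' ^ Suc n"
        unfolding distrib_left[symmetric] norm_mult
        using step_le[of n] step_nonneg[of n] by (simp only: real_norm_def abs_of_nonneg of_nat_0_le_iff) (intro mult_left_mono, auto)
    qed
  qed (use dec d in \<open>auto simp: sum_nonneg w_nonneg\<close>)
  then show ?thesis unfolding u_def by blast
qed

section \<open>Blocks of sizes one and two\<close>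

lemma indec_1: "(id, id) \<in> indec 1"
  by (simp add: indec_def pairs_def perms_def permutes_id)

text \<open>The only candidate cut is \<open>1\<close>, and the transposition does not respect
  it.\<close>

lemma indec_2: "(id, Transposition.transpose 1 2) \<in> indec 2"
proof -
  have "\<not> splits (Transposition.transpose 1 2) (1 :: nat)"
  proof
    assume "splits (Transposition.transpose 1 2) (1 :: nat)"
    then have "Transposition.transpose 1 2 (1 :: nat) \<le> 1" unfolding splits_def by blast
    then show False by simp
  qed
  moreover have "{1..<2 :: nat} = {1}" by auto
  moreover have "Transposition.transpose 1 2 permutes {1..2 :: nat}"
    by (rule permutes_swap_id) auto
  ultimately show ?thesis
    by (simp add: indec_def pairs_def perms_def permutes_id)
qed

lemma pair_LCS_1: "pair_LCS 1 (id, id) = 1"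
proof -
  have "common_chain 1 id id {(1, 1)}" by (rule common_chainI) auto
  from card_le_LCS[OF this] LCS_le[of 1 id id] show ?thesis by (simp add: pair_LCS_def)
qed

text \<open>The only possible matches are \<open>(1, 2)\<close> and \<open>(2, 1)\<close>, and they
  cross.\<close>

lemma pair_LCS_2: "pair_LCS 2 (id, Transposition.transpose 1 2) \<le> 1"
proof -
  obtain S where S: "common_chain 2 id (Transposition.transpose 1 2) S" "card S = pair_LCS 2 (id, Transposition.transpose 1 2)"
    unfolding pair_LCS_def fst_conv snd_conv using LCS_attained by blast
  have sub: "x = (1, 2) \<or> x = (2, 1)" if "x \<in> S" for x
  proof -
    obtain i j where x: "x = (i, j)" by force
    have "i \<in> {1..2}" "j \<in> {1..2}" "i = Transposition.transpose 1 2 j"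
      using common_chainD[OF S(1), of i j] that x by auto
    then show ?thesis using x by (auto simp: Transposition.transpose_def split: if_splits)
  qed
  have "x = y" if "x \<in> S" "y \<in> S" for x y
    using sub[OF that(1)] sub[OF that(2)] common_chain_less[OF S(1), of 1 2 2 1] that by auto
  then have "card S \<le> Suc 0"
    unfolding card_le_Suc0_iff_eq[OF common_chain_finite[OF S(1)]] by blast
  then show ?thesis by (simp only: S(2) One_nat_def)
qed

lemma LCS_characteristic_limit:
  fixes q q' :: real
  assumes q: "0 < q" "q < 1" and q': "0 < q'" "q' < 1"
  shows "\<exists>\<sigma>>0. \<exists>a>0. \<forall>\<theta>.
    (\<lambda>n. (\<Sum>x\<in>pairs n. of_real (pair_weight q q' n x) *
        cis (\<theta> / (\<sigma> * sqrt n) * (real (pair_LCS n x) - a * real n))) / of_real (sum (pair_weight q q' n) (pairs n)))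
    \<longlonglongrightarrow> of_real (exp (- (\<theta>\<^sup>2) / 2))"
proof -
  define w where "w = pair_weight q q'"
  define f where "f k = sum (w k) (indec k)" for k
  define u where "u n = sum (w n) (pairs n)" for n
  obtain c where "renewal f u c"
    using mallows_renewal[OF assms] unfolding f_def u_def w_def by blast
  then interpret renewal f u c .
  have w_pos: "w n x > 0" for n x
    using assms by (simp add: w_def pair_weight_def)
  define y where "y k = (\<Sum>x\<in>indec k. w k x * pair_LCS k x)" for k
  have y_le: "y k \<le> real k * f k" for k
    unfolding y_def f_def sum_distrib_left
    by (rule sum_mono) (use w_pos pair_LCS_le in \<open>simp add: mult.commute mult_left_mono less_imp_le\<close>)
  have term_nonneg: "w k x * real (pair_LCS k x) \<ge> 0" for k x
    using w_pos[of k x] by simp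
  have y_nonneg: "y k \<ge> 0" for k
    unfolding y_def by (intro sum_nonneg term_nonneg)
  have sum_y: "summable y"
    by (rule summable_comparison_test'[OF sums_summable[OF f_moment1]]) (use y_le y_nonneg in auto)
  \<comment> \<open>The mean LCS of a block divided by the mean block size \<open>1 / c\<close>,
    which is the centring that makes \<open>W\<close> average to zero.\<close>
  define a where "a = c * suminf y"
  \<comment> \<open>The resulting bound \<open>a \<le> 1\<close> is used for
    \<open>\<bar>W k x\<bar> \<le> k\<close>.\<close>
  have "suminf y \<le> 1 / c"
    using suminf_le[OF y_le sum_y] f_moment1 by (simp add: sums_iff)
  then have a_le: "a \<le> 1" using c_pos by (simp add: a_def field_simps)
  \<comment> \<open>The block of size \<open>1\<close> alone makes the mean LCS positive.\<close>
  have "0 < w 1 (id, id) * pair_LCS 1 (id, id)"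
    unfolding pair_LCS_1 using w_pos[of 1 "(id, id)"] by simp
  also have "\<dots> \<le> y 1"
    unfolding y_def by (rule member_le_sum[OF indec_1]) (rule term_nonneg finite_indec)+
  also have "\<dots> = sum y {1}" by simp
  also have "\<dots> \<le> suminf y" by (rule sum_le_suminf[OF sum_y]) (use y_nonneg in auto)
  finally have a_pos: "a > 0" using c_pos by (simp add: a_def)
  define W where "W k x = real (pair_LCS k x) - a * real k" for k x
  define r where "r t n = (\<Sum>x\<in>pairs n. of_real (w n x) * cis (t * W n x))" for t n
  interpret renewal_reward f u c indec w W r
  proof
    show "finite (indec k)" for k by (rule finite_indec)
    show "w k x \<ge> 0" for k x using w_pos less_imp_le by blast
    show "f k = sum (w k) (indec k)" for k by (rule f_def)
    show "\<bar>W k x\<bar> \<le> real k" for k x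
    proof -
      have "a * real k \<le> 1 * real k" using a_le by (intro mult_right_mono) auto
      moreover have "a * real k \<ge> 0" using a_pos by simp
      moreover have "real (pair_LCS k x) \<le> real k" using pair_LCS_le by simp
      ultimately show ?thesis unfolding W_def by linarith
    qed
    have "(\<lambda>k. y k - a * (real k * f k)) sums (suminf y - a * (1 / c))"
      by (intro sums_diff sums_mult f_moment1 summable_sums sum_y)
    also have "suminf y - a * (1 / c) = 0" using c_pos by (simp add: a_def)
    also have "(\<lambda>k. y k - a * (real k * f k)) = (\<lambda>k. \<Sum>x\<in>indec k. w k x * W k x)"
      by (simp add: y_def f_def W_def sum_subtractf sum_distrib_left algebra_simps)
    finally show "(\<lambda>k. \<Sum>x\<in>indec k. w k x * W k x) sums 0" .
    show "r t n = (if n = 0 then 1 else 0)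
      + (\<Sum>k\<le>n. (\<Sum>x\<in>indec k. of_real (w k x) * cis (t * W k x)) * r t (n - k))" for t n
      unfolding r_def
    proof (rule sum_pairs_renewal)
      show "of_real (w 0 (id, id)) * cis (t * W 0 (id, id)) = 1"
        using pair_LCS_le[of 0 "(id, id)"] by (simp add: w_def pair_weight_0 W_def)
      fix k m x y assume "x \<in> pairs k" "y \<in> pairs m"
      then have "w (k + m) (psum2 k x y) = w k x * w m y" "W (k + m) (psum2 k x y) = W k x + W m y"
        by (simp_all add: w_def W_def pair_weight_psum2 pair_LCS_psum2 algebra_simps)
      then show "complex_of_real (w (k + m) (psum2 k x y)) * cis (t * W (k + m) (psum2 k x y)) =
          of_real (w k x) * cis (t * W k x) * (of_real (w m y) * cis (t * W m y))"
        by (simp add: distrib_left cis_mult[symmetric])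
    qed
  qed
  \<comment> \<open>If \<open>V\<close> vanished, every block would have LCS exactly
    \<open>a\<close> times its size: size \<open>1\<close> gives \<open>a = 1\<close>, contradicting
    the block of size \<open>2\<close> with LCS at most \<open>1\<close>.\<close>
  have V_pos: "V > 0"
  proof (rule ccontr)
    assume "\<not> V > 0"
    then have V0: "(\<Sum>x\<in>indec k. w k x * (W k x)\<^sup>2) \<le> 0" for k
      using V_ge[of "{k}"] by simp
    have nonneg: "w k x * (W k x)\<^sup>2 \<ge> 0" for k x
      using w_pos[of k x] by simp
    have W0: "W k x = 0" if x: "x \<in> indec k" for k x
    proof -
      have "w k x * (W k x)\<^sup>2 \<le> (\<Sum>x\<in>indec k. w k x * (W k x)\<^sup>2)"
        by (rule member_le_sum[OF x]) (rule nonneg finite_indec)+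
      then have "w k x * (W k x)\<^sup>2 = 0" using V0[of k] nonneg[of k x] by linarith
      then show ?thesis using w_pos[of k x] by simp
    qed
    have "a = 1" using W0[OF indec_1] by (simp add: W_def pair_LCS_1[simplified])
    moreover have "real (pair_LCS 2 (id, Transposition.transpose 1 2)) \<le> 1"
      using pair_LCS_2 by simp
    ultimately show False using W0[OF indec_2] by (simp add: W_def)
  qed
  \<comment> \<open>Variance per unit length: block variance \<open>V\<close> times the block
    density \<open>c\<close>.\<close>
  define \<sigma> where "\<sigma> = sqrt (V * c)"
  have \<sigma>_pos: "\<sigma> > 0" using V_pos c_pos by (simp add: \<sigma>_def)
  have "(\<lambda>n. r (\<theta> / (\<sigma> * sqrt n)) n / of_real (u n)) \<longlonglongrightarrow> of_real (exp (- (\<theta>\<^sup>2) / 2))" for \<theta>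
  proof -
    \<comment> \<open>Dividing by \<open>u n\<close>, which tends to \<open>c\<close>, normalises
      and removes the prefactor in \<open>r_limit\<close>.\<close>
    have "(\<lambda>n. r (\<theta> / \<sigma> / sqrt n) n / of_real (u n))
        \<longlonglongrightarrow> of_real (c * exp (- (V * c / 2 * (\<theta> / \<sigma>)\<^sup>2))) / of_real c"
      using c_pos by (intro tendsto_divide r_limit tendsto_of_real u_lim) auto
    moreover have "V * c / 2 * (\<theta> / \<sigma>)\<^sup>2 = \<theta>\<^sup>2 / 2"
      using V_pos c_pos by (simp add: \<sigma>_def power_divide)
    ultimately show ?thesis using c_pos by simp
  qed
  then show ?thesis
    using \<sigma>_pos a_pos unfolding r_def u_def W_def w_def by blast
qed

section \<open>Joint law of the random pair and convergence in distribution\<close>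

text \<open>Independence makes the joint law a product measure, and on a finite space it suffices to
  compare singletons.\<close>

lemma distr_mallows_pair:
  assumes "prob_space M" and q: "0 < q" "0 < q'"
    and indep: "prob_space.indep_var M (count_space (perms n)) \<pi> (count_space (perms n)) \<tau>"
    and \<pi>: "distr M (count_space (perms n)) \<pi> = mallows_measure n q"
    and \<tau>: "distr M (count_space (perms n)) \<tau> = mallows_measure n q'"
  shows "(\<lambda>\<omega>. (\<pi> \<omega>, \<tau> \<omega>)) \<in> M \<rightarrow>\<^sub>M count_space (pairs n)"
    and "distr M (count_space (pairs n)) (\<lambda>\<omega>. (\<pi> \<omega>, \<tau> \<omega>)) =
      point_measure (pairs n) (\<lambda>x. ennreal (q ^ inversion_number n (fst x) / mallows_Z n q
        * (q' ^ inversion_number n (snd x) / mallows_Z n q')))"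
proof -
  interpret prob_space M by fact
  let ?C = "count_space (perms n)"
  have rv: "random_variable ?C \<pi>" "random_variable ?C \<tau>"
    using indep by (auto simp: indep_var_distribution_eq)
  have C: "?C \<Otimes>\<^sub>M ?C = count_space (pairs n)"
    unfolding pairs_def by (rule pair_measure_count_space) (rule finite_perms)+
  have "(\<lambda>\<omega>. (\<pi> \<omega>, \<tau> \<omega>)) \<in> M \<rightarrow>\<^sub>M ?C \<Otimes>\<^sub>M ?C" using rv by (rule measurable_Pair)
  then show "(\<lambda>\<omega>. (\<pi> \<omega>, \<tau> \<omega>)) \<in> M \<rightarrow>\<^sub>M count_space (pairs n)" by (simp only: C)
  interpret q': prob_space "mallows_measure n q'" by (rule prob_space_mallows_measure[OF q(2)])
  have J: "distr M (count_space (pairs n)) (\<lambda>\<omega>. (\<pi> \<omega>, \<tau> \<omega>)) = mallows_measure n q \<Otimes>\<^sub>M mallows_measure n q'"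
    using indep unfolding indep_var_distribution_eq \<pi> \<tau> C by simp
  have single: "emeasure (mallows_measure n q) {p} = ennreal (q ^ inversion_number n p / mallows_Z n q)"
    if "p \<in> perms n" for p q
    using that unfolding mallows_measure_def by (subst emeasure_point_measure_finite) (auto simp: finite_perms)
  show "distr M (count_space (pairs n)) (\<lambda>\<omega>. (\<pi> \<omega>, \<tau> \<omega>)) =
      point_measure (pairs n) (\<lambda>x. ennreal (q ^ inversion_number n (fst x) / mallows_Z n q
        * (q' ^ inversion_number n (snd x) / mallows_Z n q')))" (is "?L = point_measure _ ?g")
  proof (rule measure_eqI_finite)
    show "sets ?L = Pow (pairs n)" by simp
    show "sets (point_measure (pairs n) ?g) = Pow (pairs n)" by (simp add: sets_point_measure)
    show "finite (pairs n)" by (rule finite_pairs)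
    fix x assume x: "x \<in> pairs n"
    obtain p t where pt: "x = (p, t)" "p \<in> perms n" "t \<in> perms n" using x by (auto simp: pairs_def)
    have "emeasure ?L {x} = emeasure (mallows_measure n q \<Otimes>\<^sub>M mallows_measure n q') ({p} \<times> {t})"
      unfolding J pt by simp
    also have "\<dots> = emeasure (mallows_measure n q) {p} * emeasure (mallows_measure n q') {t}"
      using pt by (intro q'.emeasure_pair_measure_Times) (auto simp: mallows_measure_def sets_point_measure)
    also have "\<dots> = ?g x"
      unfolding single[OF pt(2)] single[OF pt(3)] pt(1) fst_conv snd_conv
      using q mallows_Z_pos[OF q(1), of n] mallows_Z_pos[OF q(2), of n]
      by (intro ennreal_mult[symmetric]) auto
    also have "\<dots> = emeasure (point_measure (pairs n) ?g) {x}"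
      using x by (subst emeasure_point_measure_finite) (auto simp: finite_pairs)
    finally show "emeasure ?L {x} = emeasure (point_measure (pairs n) ?g) {x}" .
  qed
qed

lemma char_LCS:
  fixes \<theta> \<sigma> a :: real
  assumes "prob_space M" and q: "0 < q" "q < 1" "0 < q'" "q' < 1"
    and "prob_space.indep_var M (count_space (perms n)) \<pi> (count_space (perms n)) \<tau>"
    and "distr M (count_space (perms n)) \<pi> = mallows_measure n q"
    and "distr M (count_space (perms n)) \<tau> = mallows_measure n q'"
  defines "D \<equiv> distr M borel (\<lambda>\<omega>. (real (LCS n (\<pi> \<omega>) (\<tau> \<omega>)) - a * real n) / (\<sigma> * sqrt (real n)))"
  shows "real_distribution D"
    and "char D \<theta> = (\<Sum>x\<in>pairs n. of_real (pair_weight q q' n x) *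
        cis (\<theta> / (\<sigma> * sqrt n) * (real (pair_LCS n x) - a * real n))) / of_real (sum (pair_weight q q' n) (pairs n))"
proof -
  interpret prob_space M by fact
  define X where "X x = (real (pair_LCS n x) - a * real n) / (\<sigma> * sqrt (real n))" for x
  define g where "g x = q ^ inversion_number n (fst x) / mallows_Z n q
        * (q' ^ inversion_number n (snd x) / mallows_Z n q')" for x
  note P = distr_mallows_pair[OF assms(1) q(1,3) assms(6-8)]
  have D: "D = distr M borel (\<lambda>\<omega>. X (\<pi> \<omega>, \<tau> \<omega>))"
    unfolding D_def X_def pair_LCS_def by simp
  have meas: "(\<lambda>\<omega>. X (\<pi> \<omega>, \<tau> \<omega>)) \<in> M \<rightarrow>\<^sub>M borel"
    by (rule measurable_compose[OF P(1)]) simp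
  show "real_distribution D" unfolding D by (rule real_distribution_distr[OF meas])
  have Zpos: "mallows_Z n q > 0" "mallows_Z n q' > 0"
    using q by (auto intro: mallows_Z_pos)
  \<comment> \<open>The powers of \<open>(1 - q) * (1 - q')\<close> in the weight and in the total
    weight cancel, leaving the Mallows probabilities.\<close>
  have g: "complex_of_real (g x) = of_real (pair_weight q q' n x) / of_real (sum (pair_weight q q' n) (pairs n))" for x
  proof -
    have "g x = pair_weight q q' n x / sum (pair_weight q q' n) (pairs n)"
      unfolding g_def sum_pair_weight_eq_Z pair_weight_def using q Zpos by simp
    then show ?thesis by (simp only: of_real_divide)
  qed
  have "char D \<theta> = (\<integral>\<omega>. iexp (\<theta> * X (\<pi> \<omega>, \<tau> \<omega>)) \<partial>M)"
    unfolding D char_def by (subst integral_distr[OF meas]) auto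
  also have "\<dots> = (\<integral>x. iexp (\<theta> * X x) \<partial>distr M (count_space (pairs n)) (\<lambda>\<omega>. (\<pi> \<omega>, \<tau> \<omega>)))"
    by (subst integral_distr[OF P(1)]) auto
  also have "\<dots> = (\<Sum>x\<in>pairs n. g x *\<^sub>R iexp (\<theta> * X x))"
    unfolding P(2) g_def[symmetric] using q Zpos
    by (intro lebesgue_integral_point_measure_finite finite_pairs) (auto simp: g_def)
  also have "\<dots> = (\<Sum>x\<in>pairs n. of_real (pair_weight q q' n x) *
        cis (\<theta> / (\<sigma> * sqrt n) * (real (pair_LCS n x) - a * real n)) / of_real (sum (pair_weight q q' n) (pairs n)))"
    by (intro sum.cong) (auto simp: scaleR_conv_of_real g X_def cis_conv_exp)
  finally show "char D \<theta> = (\<Sum>x\<in>pairs n. of_real (pair_weight q q' n x) *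
        cis (\<theta> / (\<sigma> * sqrt n) * (real (pair_LCS n x) - a * real n))) / of_real (sum (pair_weight q q' n) (pairs n))"
    by (simp add: sum_divide_distrib)
qed

theorem theorem2:
  fixes q q' :: real
  assumes "0 < q" and "q < 1" and "0 < q'" and "q' < 1"
  shows "\<exists>\<sigma> > 0. \<exists>a > 0.
    \<forall>(M :: nat \<Rightarrow> 'w measure) (\<pi> :: nat \<Rightarrow> 'w \<Rightarrow> (nat \<Rightarrow> nat)) (\<tau> :: nat \<Rightarrow> 'w \<Rightarrow> (nat \<Rightarrow> nat)).
      (\<forall>n > 0. prob_space (M n) \<and>
               prob_space.indep_var (M n)
                 (count_space (perms n)) (\<pi> n) (count_space (perms n)) (\<tau> n) \<and>
               distr (M n) (count_space (perms n)) (\<pi> n) = mallows_measure n q \<and>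
               distr (M n) (count_space (perms n)) (\<tau> n) = mallows_measure n q') \<longrightarrow>
      weak_conv_m
        (\<lambda>n. distr (M n) borel
           (\<lambda>\<omega>. (real (LCS n (\<pi> n \<omega>) (\<tau> n \<omega>)) - a * real n) / (\<sigma> * sqrt (real n))))
        std_normal_distribution"
proof -
  obtain \<sigma> a where pos: "\<sigma> > 0" "a > 0" and lim: "\<And>\<theta>.
    (\<lambda>n. (\<Sum>x\<in>pairs n. of_real (pair_weight q q' n x) *
        cis (\<theta> / (\<sigma> * sqrt n) * (real (pair_LCS n x) - a * real n))) / of_real (sum (pair_weight q q' n) (pairs n)))
    \<longlonglongrightarrow> of_real (exp (- (\<theta>\<^sup>2) / 2))"
    using LCS_characteristic_limit[OF assms] by blast
  show ?thesis
  proof (rule exI[of _ \<sigma>], rule conjI[OF pos(1)], rule exI[of _ a], rule conjI[OF pos(2)], intro allI impI)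
    fix M :: "nat \<Rightarrow> 'w measure" and \<pi> \<tau> :: "nat \<Rightarrow> 'w \<Rightarrow> (nat \<Rightarrow> nat)"
    assume *: "\<forall>n > 0. prob_space (M n) \<and>
               prob_space.indep_var (M n)
                 (count_space (perms n)) (\<pi> n) (count_space (perms n)) (\<tau> n) \<and>
               distr (M n) (count_space (perms n)) (\<pi> n) = mallows_measure n q \<and>
               distr (M n) (count_space (perms n)) (\<tau> n) = mallows_measure n q'"
    define D where "D = (\<lambda>n. distr (M n) borel
       (\<lambda>\<omega>. (real (LCS n (\<pi> n \<omega>) (\<tau> n \<omega>)) - a * real n) / (\<sigma> * sqrt (real n))))"
    \<comment> \<open>The hypotheses concern positive \<open>n\<close> only, whereas Levy's theorem
      is applied to a sequence all of whose members are distributions; hence the shift to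
      \<open>Suc n\<close>, undone at the end.\<close>
    have "real_distribution (D (Suc n))" for n
      unfolding D_def using * by (intro char_LCS(1)[OF _ assms]) auto
    moreover have "char (D (Suc n)) \<theta> = (\<Sum>x\<in>pairs (Suc n). of_real (pair_weight q q' (Suc n) x) *
        cis (\<theta> / (\<sigma> * sqrt (Suc n)) * (real (pair_LCS (Suc n) x) - a * real (Suc n)))) / of_real (sum (pair_weight q q' (Suc n)) (pairs (Suc n)))" for n \<theta>
      unfolding D_def using * by (intro char_LCS(2)[OF _ assms]) auto
    then have "(\<lambda>n. char (D (Suc n)) \<theta>) \<longlonglongrightarrow> char std_normal_distribution \<theta>" for \<theta>
      using LIMSEQ_Suc[OF lim[of \<theta>]] by (simp only: char_std_normal_distribution)
    ultimately have "weak_conv_m (\<lambda>n. D (Suc n)) std_normal_distribution"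
      by (intro levy_continuity real_dist_normal_dist)
    then have "weak_conv_m D std_normal_distribution"
      unfolding weak_conv_m_def weak_conv_def
      using LIMSEQ_imp_Suc[of "\<lambda>n. cdf (D n) _"] by blast
    then show "weak_conv_m (\<lambda>n. distr (M n) borel
       (\<lambda>\<omega>. (real (LCS n (\<pi> n \<omega>) (\<tau> n \<omega>)) - a * real n) / (\<sigma> * sqrt (real n))))
       std_normal_distribution"
      unfolding D_def .
  qed
qed

end
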